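(* Let $P$ be an algebraically closed field of characteristic $p>2$, let $n\ge 1$ and $G_n=Sp_{2n}(P)$. Let $\phi_n^1$ be the irreducible rational representation of $G_n$ with highest weight $\omega_n'$ and $\phi_n^2$ the irreducible rational representation with highest weight $\omega_n''$. Then for $i=1,2$: (A) $\dim \phi_n^i=\dfrac{p^n+(-1)^i}{2}$; (B) every weight of $\phi_n^i$ (with respect to a maximal torus of $G_n$) occurs with multiplicity $1$, i.e. all weight subspaces of $\phi_n^i$ are $1$-dimensional.
   Context: $G_n=Sp_{2n}(P)$ is regarded as the simply connected simple algebraic group of type $C_n$, with simple roots $\alpha_1,\dots,\alpha_n$ labelled as in Bourbaki ($\alpha_n$ is the long simple root) and corresponding fundamental weights $\omega_1,\dots,\omega_n$. Define $\omega_n'=\omega_{n-1}+\frac{p-3}{2}\omega_n$ if $n>1$ and $\omega_1'=\frac{p-3}{2}\omega_1$ if $n=1$; define $\omega_n''=\frac{p-1}{2}\omega_n$. *)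

theory Defs
  imports "HOL-Analysis.Analysis" "HOL-Computational_Algebra.Polynomial"
begin

definition alg_closed :: "'a::field itself \<Rightarrow> bool" where
  "alg_closed _ \<longleftrightarrow> (\<forall>q::'a poly. degree q > 0 \<longrightarrow> (\<exists>x. poly q x = 0))"

text \<open>(2n x 2n)-matrices are functions nat => nat => 'a, supported on indices < 2n.
  Indices 0..n-1 and n..2n-1 correspond to the two Lagrangian blocks.\<close>
type_synonym 'a mat2 = "nat \<Rightarrow> nat \<Rightarrow> 'a"

definition supp_mat :: "nat \<Rightarrow> 'a::zero mat2 \<Rightarrow> bool" where
  "supp_mat n g \<longleftrightarrow> (\<forall>i j. (i \<ge> 2*n \<or> j \<ge> 2*n) \<longrightarrow> g i j = 0)"

definition mmul :: "nat \<Rightarrow> 'a::comm_ring_1 mat2 \<Rightarrow> 'a mat2 \<Rightarrow> 'a mat2" where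
  "mmul n a b = (\<lambda>i j. \<Sum>k<2*n. a i k * b k j)"

definition mtrans :: "'a mat2 \<Rightarrow> 'a mat2" where
  "mtrans a = (\<lambda>i j. a j i)"

definition mid :: "nat \<Rightarrow> 'a::comm_ring_1 mat2" where
  "mid n = (\<lambda>i j. if i = j \<and> i < 2*n then 1 else 0)"

definition Jmat :: "nat \<Rightarrow> 'a::comm_ring_1 mat2" where
  "Jmat n = (\<lambda>i j. if i < n \<and> j = i + n then 1
                   else if n \<le> i \<and> i < 2*n \<and> j + n = i then -1 else 0)"

definition Sp :: "nat \<Rightarrow> 'a::comm_ring_1 mat2 set" where
  "Sp n = {g. supp_mat n g \<and> mmul n (mmul n (mtrans g) (Jmat n)) g = Jmat n}"

text \<open>Polynomial functions in the matrix entries (the coordinate ring of Sp_{2n}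
  is a quotient of the polynomial ring in the entries, as Sp_{2n} \<subseteq> SL_{2n}).\<close>
inductive_set poly_fun :: "nat \<Rightarrow> ('a::comm_ring_1 mat2 \<Rightarrow> 'a) set" for n where
  pf_const: "(\<lambda>g. c) \<in> poly_fun n"
| pf_coord: "i < 2*n \<Longrightarrow> j < 2*n \<Longrightarrow> (\<lambda>g. g i j) \<in> poly_fun n"
| pf_add: "f \<in> poly_fun n \<Longrightarrow> h \<in> poly_fun n \<Longrightarrow> (\<lambda>g. f g + h g) \<in> poly_fun n"
| pf_mult: "f \<in> poly_fun n \<Longrightarrow> h \<in> poly_fun n \<Longrightarrow> (\<lambda>g. f g * h g) \<in> poly_fun n"

definition rational_rep :: "nat \<Rightarrow> ('a::field mat2 \<Rightarrow> 'a^'d^'d) \<Rightarrow> bool" where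
  "rational_rep n \<rho> \<longleftrightarrow>
     \<rho> (mid n) = mat 1 \<and>
     (\<forall>g\<in>Sp n. \<forall>h\<in>Sp n. \<rho> (mmul n g h) = \<rho> g ** \<rho> h) \<and>
     (\<forall>a b. \<exists>f\<in>poly_fun n. \<forall>g\<in>Sp n. \<rho> g $ a $ b = f g)"

definition irreducible_rep :: "nat \<Rightarrow> ('a::field mat2 \<Rightarrow> 'a^'d^'d) \<Rightarrow> bool" where
  "irreducible_rep n \<rho> \<longleftrightarrow>
     (\<forall>W. vec.subspace W \<and> (\<forall>g\<in>Sp n. \<forall>w\<in>W. \<rho> g *v w \<in> W)
          \<longrightarrow> W = {0} \<or> W = UNIV)"

definition torus_elt :: "nat \<Rightarrow> (nat \<Rightarrow> 'a::field) \<Rightarrow> 'a mat2" where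
  "torus_elt n t = (\<lambda>i j. if i = j \<and> i < n then t i
                         else if i = j \<and> n \<le> i \<and> i < 2*n then inverse (t (i - n)) else 0)"

text \<open>Weights are integer vectors (coefficients w.r.t. eps_1..eps_n, stored at
  indices 0..n-1, zero elsewhere).\<close>
definition character :: "nat \<Rightarrow> (nat \<Rightarrow> int) \<Rightarrow> (nat \<Rightarrow> 'a::field) \<Rightarrow> 'a" where
  "character n lam t = (\<Prod>i<n. t i powi lam i)"

definition weight_space :: "nat \<Rightarrow> ('a::field mat2 \<Rightarrow> 'a^'d^'d) \<Rightarrow> (nat \<Rightarrow> int) \<Rightarrow> ('a^'d) set" where
  "weight_space n \<rho> lam =
     {v. \<forall>t. (\<forall>i<n. t i \<noteq> 0) \<longrightarrow> \<rho> (torus_elt n t) *v v = character n lam t *s v}"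

definition is_weight :: "nat \<Rightarrow> ('a::field mat2 \<Rightarrow> 'a^'d^'d) \<Rightarrow> (nat \<Rightarrow> int) \<Rightarrow> bool" where
  "is_weight n \<rho> lam \<longleftrightarrow> (\<forall>i\<ge>n. lam i = 0) \<and> weight_space n \<rho> lam \<noteq> {0}"

text \<open>eps_k (1-indexed), simple roots alpha_k (Bourbaki, type C_n, alpha_n = 2 eps_n long),
  fundamental weights omega_k = eps_1 + ... + eps_k.\<close>
definition eps :: "nat \<Rightarrow> nat \<Rightarrow> int" where
  "eps k = (\<lambda>j. if j = k - 1 then 1 else 0)"

definition simple_root :: "nat \<Rightarrow> nat \<Rightarrow> nat \<Rightarrow> int" where
  "simple_root n k = (if k < n then (\<lambda>j. eps k j - eps (k+1) j) else (\<lambda>j. 2 * eps n j))"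

definition fund_weight :: "nat \<Rightarrow> nat \<Rightarrow> int" where
  "fund_weight k = (\<lambda>j. if j < k then 1 else 0)"

definition highest_weight :: "nat \<Rightarrow> ('a::field mat2 \<Rightarrow> 'a^'d^'d) \<Rightarrow> (nat \<Rightarrow> int) \<Rightarrow> bool" where
  "highest_weight n \<rho> lam \<longleftrightarrow> is_weight n \<rho> lam \<and>
     (\<forall>\<mu>. is_weight n \<rho> \<mu> \<longrightarrow>
        (\<exists>c::nat \<Rightarrow> nat. \<forall>j. lam j - \<mu> j = (\<Sum>k\<in>{1..n}. int (c k) * simple_root n k j)))"

definition omega' :: "nat \<Rightarrow> nat \<Rightarrow> nat \<Rightarrow> int" where
  "omega' p n = (if n > 1 then (\<lambda>j. fund_weight (n-1) j + ((int p - 3) div 2) * fund_weight n j)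
                 else (\<lambda>j. ((int p - 3) div 2) * fund_weight 1 j))"

definition omega'' :: "nat \<Rightarrow> nat \<Rightarrow> nat \<Rightarrow> int" where
  "omega'' p n = (\<lambda>j. ((int p - 1) div 2) * fund_weight n j)"

end

theory Submission
  imports Defs
begin

text \<open>
  Put \<open>m = (p - 1) / 2\<close>. In coordinates, the highest weight is \<open>(m, \<dots>, m, m - \<delta>)\<close> with \<open>\<delta> = 1\<close> for
  \<open>\<omega>'\<close> and \<open>\<delta> = 0\<close> for \<open>\<omega>''\<close>. The Weyl group therefore forces every weight into the cube
  \<open>|\<mu>\<^sub>j| \<le> m\<close>, which is so small that a root subgroup acts as a polynomial of degree less than \<open>p\<close>,
  that is, as the exponential of its linear term. Since the simple root subgroups generate the
  symplectic group, the module is already irreducible under the simple root vectors \<open>e\<^sub>k\<close>, \<open>f\<^sub>k\<close>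
  of the Lie algebra.

  It is compared with the oscillator (Weil) representation by differential operators on
  polynomials. Let \<open>R\<close> be the span of all pairs obtained by applying the same word in the \<open>f\<^sub>k\<close>
  to the pair of a highest weight vector and the monomial of the same weight. The Chevalley
  relations make \<open>R\<close> stable under the \<open>e\<^sub>k\<close>, and irreducibility shows that a vector is
  determined by its partner under \<open>R\<close>; hence weight spaces, being matched with single monomials,
  are at most one-dimensional. Starting from the highest weight, every weight of the cube with
  the right parity is reached by steps \<open>f\<^sub>k\<close> that \<open>e\<^sub>k\<close> undoes up to a nonzero scalar, so exactly
  these weights occur; there are \<open>(p\<^sup>n \<plusminus> 1) / 2\<close> of them.
\<close>

section \<open>The symplectic group and row operations\<close>

lemma sum_lessThan_double: "(\<Sum>k<2*n. f k) = (\<Sum>k<n. f k + f (k+n))" for f :: "nat \<Rightarrow> 'a::comm_monoid_add"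
proof -
  have "(\<Sum>k<2*n. f k) = (\<Sum>k<n. f k) + (\<Sum>k=n..<n+n. f k)"
    by (simp add: lessThan_atLeast0 sum.atLeastLessThan_concat mult_2)
  also have "(\<Sum>k=n..<n+n. f k) = (\<Sum>k<n. f (k+n))"
    using sum.shift_bounds_nat_ivl[of f 0 n n] by (simp add: lessThan_atLeast0)
  finally show ?thesis by (simp add: sum.distrib)
qed

lemma less_double_cases:
  fixes r n :: nat obtains "r < n" | i where "i < n" "r = i + n" | "r \<ge> 2 * n"
  by (metis le_add_diff_inverse2 less_diff_conv2 linorder_not_less mult_2)

text \<open>The alternating form with matrix \<open>Jmat\<close>. Group membership becomes a
  condition on pairs of columns, which row operations are easily seen to preserve.\<close>

definition symp_form :: "nat \<Rightarrow> (nat \<Rightarrow> 'a::comm_ring_1) \<Rightarrow> (nat \<Rightarrow> 'a) \<Rightarrow> 'a" where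
  "symp_form n u v = (\<Sum>i<n. u i * v (i+n) - u (i+n) * v i)"

lemma mmul_Jmat:
  "mmul n (mmul n (mtrans g) (Jmat n)) h a b = symp_form n (\<lambda>r. g r a) (\<lambda>r. h r b)"
proof -
  have 1: "(\<Sum>l<2*n. g l a * Jmat n l k) = - g (k+n) a" if "k < n" for k
  proof -
    have "(\<Sum>l<2*n. g l a * Jmat n l k) = (\<Sum>l<n. if l = k then - g (k+n) a else 0)"
      unfolding sum_lessThan_double by (rule sum.cong) (use that in \<open>auto simp: Jmat_def\<close>)
    then show ?thesis using that by simp
  qed
  have 2: "(\<Sum>l<2*n. g l a * Jmat n l (k+n)) = g k a" if "k < n" for k
  proof -
    have "(\<Sum>l<2*n. g l a * Jmat n l (k+n)) = (\<Sum>l<n. if l = k then g k a else 0)"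
      unfolding sum_lessThan_double by (rule sum.cong) (use that in \<open>auto simp: Jmat_def\<close>)
    then show ?thesis using that by simp
  qed
  show ?thesis
    unfolding mmul_def mtrans_def symp_form_def
    by (subst sum_lessThan_double) (rule sum.cong, auto simp: 1 2)
qed

lemma Sp_iff:
  "g \<in> Sp n \<longleftrightarrow> supp_mat n g \<and> (\<forall>a b. symp_form n (\<lambda>r. g r a) (\<lambda>r. g r b) = Jmat n a b)"
  unfolding Sp_def by (auto simp: fun_eq_iff mmul_Jmat)

lemma supp_mid: "supp_mat n (mid n)"
  by (auto simp: supp_mat_def mid_def)

lemma mid_in_Sp: "(mid n :: 'a::comm_ring_1 mat2) \<in> Sp n"
proof -
  have "symp_form n (\<lambda>r. mid n r a) (\<lambda>r. mid n r b) = (Jmat n a b :: 'a)" for a b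
  proof -
    have "symp_form n (\<lambda>r. mid n r a) (\<lambda>r. mid n r b :: 'a)
      = (\<Sum>i<n. (if i = a then (if b = a + n then 1 else 0) else 0) - (if i = b then (if a = b + n then 1 else 0) else 0))"
      unfolding symp_form_def by (rule sum.cong) (auto simp: mid_def)
    also have "\<dots> = Jmat n a b"
      by (auto simp: sum_subtractf Jmat_def)
    finally show ?thesis .
  qed
  then show ?thesis by (simp add: Sp_iff supp_mid)
qed

lemma mid_mult_sum: "supp_mat n g \<Longrightarrow> (\<Sum>k<2*n. mid n r k * g k c) = g r c"
proof -
  assume "supp_mat n g"
  have "(\<Sum>k<2*n. mid n r k * g k c) = (\<Sum>k<2*n. if r = k then g r c else 0)"
    by (rule sum.cong) (auto simp: mid_def)
  then show ?thesis using \<open>supp_mat n g\<close> by (auto simp: supp_mat_def)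
qed

text \<open>A row operation that is left multiplication by the group element
  \<open>T (mid n)\<close>. Identities in the group can then be checked entry by entry, without
  multiplying matrices.\<close>

definition symp_op :: "nat \<Rightarrow> ('a::comm_ring_1 mat2 \<Rightarrow> 'a mat2) \<Rightarrow> bool" where
  "symp_op n T \<longleftrightarrow> (\<forall>g\<in>Sp n. mmul n (T (mid n)) g = T g \<and> T g \<in> Sp n)"

lemma Sp_supp: "g \<in> Sp n \<Longrightarrow> supp_mat n g"
  by (simp add: Sp_iff)

text \<open>\<open>opA\<close>, \<open>opB\<close>, \<open>opC\<close> are left multiplications by the root elements for
  \<open>\<epsilon>\<^sub>i - \<epsilon>\<^sub>j\<close>, \<open>2\<epsilon>\<^sub>i\<close>, \<open>-2\<epsilon>\<^sub>i\<close>, \<open>opD\<close> by a torus element, and \<open>opS\<close>, \<open>opW\<close> by representatives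
  of Weyl group elements; the simple roots are numbered from 0 here.\<close>

definition opA :: "nat \<Rightarrow> nat \<Rightarrow> nat \<Rightarrow> 'a::comm_ring_1 \<Rightarrow> 'a mat2 \<Rightarrow> 'a mat2" where
  "opA n i j t g = (\<lambda>r c. if r = i then g i c + t * g j c
     else if r = j + n then g (j+n) c - t * g (i+n) c else g r c)"

definition opB :: "nat \<Rightarrow> nat \<Rightarrow> 'a::comm_ring_1 \<Rightarrow> 'a mat2 \<Rightarrow> 'a mat2" where
  "opB n i t g = (\<lambda>r c. if r = i then g i c + t * g (i+n) c else g r c)"

definition opC :: "nat \<Rightarrow> nat \<Rightarrow> 'a::comm_ring_1 \<Rightarrow> 'a mat2 \<Rightarrow> 'a mat2" where
  "opC n i t g = (\<lambda>r c. if r = i + n then g (i+n) c + t * g i c else g r c)"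

definition opD :: "nat \<Rightarrow> (nat \<Rightarrow> 'a::field) \<Rightarrow> 'a mat2 \<Rightarrow> 'a mat2" where
  "opD n h g = (\<lambda>r c. if r < n then h r * g r c
     else if r < 2*n then inverse (h (r-n)) * g r c else 0)"

definition opS :: "nat \<Rightarrow> nat \<Rightarrow> 'a::comm_ring_1 mat2 \<Rightarrow> 'a mat2" where
  "opS n i g = (\<lambda>r c. if r = 0 then g i c else if r = i then g 0 c
     else if r = n then g (i+n) c else if r = i+n then g n c else g r c)"

definition opW :: "nat \<Rightarrow> 'a::comm_ring_1 \<Rightarrow> 'a mat2 \<Rightarrow> 'a mat2" where
  "opW n s g = (\<lambda>r c. if r = 0 then s * g n c else if r = n then - s * g 0 c else g r c)"

text \<open>The summands change only at \<open>i\<close> and \<open>j\<close>, by opposite amounts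
  \<open>x\<close>, which cancel.\<close>

lemma symp_form_eqI:
  assumes "i < n" "j < n"
    and "\<And>r. r < n \<Longrightarrow> u' r * v' (r+n) - u' (r+n) * v' r
       = u r * v (r+n) - u (r+n) * v r + (if r = i then x else 0) - (if r = j then x else 0)"
  shows "symp_form n u' v' = symp_form n u v"
proof -
  have "symp_form n u' v' = (\<Sum>r<n. u r * v (r+n) - u (r+n) * v r + (if r = i then x else 0) - (if r = j then x else 0))"
    unfolding symp_form_def by (rule sum.cong) (use assms(3) in auto)
  also have "\<dots> = symp_form n u v"
    using assms(1,2) by (simp add: symp_form_def sum.distrib sum_subtractf)
  finally show ?thesis .
qed

lemma symp_op_opA: assumes "i < n" "j < n" "i \<noteq> j" shows "symp_op n (opA n i j t)"
  unfolding symp_op_def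
proof (intro ballI conjI)
  fix g :: "'a mat2" assume g: "g \<in> Sp n"
  show "mmul n (opA n i j t (mid n)) g = opA n i j t g"
    using mid_mult_sum[OF Sp_supp[OF g]]
    by (auto simp: mmul_def opA_def fun_eq_iff algebra_simps sum.distrib sum_subtractf
        simp flip: sum_distrib_left)
  have "symp_form n (\<lambda>r. opA n i j t g r a) (\<lambda>r. opA n i j t g r b) = symp_form n (\<lambda>r. g r a) (\<lambda>r. g r b)" for a b
    by (rule symp_form_eqI[where i=i and j=j and x="t * (g j a * g (i+n) b - g (i+n) a * g j b)"])
       (use assms in \<open>auto simp: opA_def algebra_simps\<close>)
  then show "opA n i j t g \<in> Sp n"
    using g assms by (auto simp: Sp_iff supp_mat_def opA_def)
qed

lemma symp_op_opB: assumes "i < n" shows "symp_op n (opB n i t)"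
  unfolding symp_op_def
proof (intro ballI conjI)
  fix g :: "'a mat2" assume g: "g \<in> Sp n"
  show "mmul n (opB n i t (mid n)) g = opB n i t g"
    using mid_mult_sum[OF Sp_supp[OF g]]
    by (auto simp: mmul_def opB_def fun_eq_iff algebra_simps sum.distrib sum_subtractf
        simp flip: sum_distrib_left)
  have "symp_form n (\<lambda>r. opB n i t g r a) (\<lambda>r. opB n i t g r b) = symp_form n (\<lambda>r. g r a) (\<lambda>r. g r b)" for a b
    by (rule symp_form_eqI[where i=i and j=i and x=0])
       (use assms in \<open>auto simp: opB_def algebra_simps\<close>)
  then show "opB n i t g \<in> Sp n"
    using g assms by (auto simp: Sp_iff supp_mat_def opB_def)
qed

lemma symp_op_opC: assumes "i < n" shows "symp_op n (opC n i t)"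
  unfolding symp_op_def
proof (intro ballI conjI)
  fix g :: "'a mat2" assume g: "g \<in> Sp n"
  show "mmul n (opC n i t (mid n)) g = opC n i t g"
    using mid_mult_sum[OF Sp_supp[OF g]]
    by (auto simp: mmul_def opC_def fun_eq_iff algebra_simps sum.distrib sum_subtractf
        simp flip: sum_distrib_left)
  have "symp_form n (\<lambda>r. opC n i t g r a) (\<lambda>r. opC n i t g r b) = symp_form n (\<lambda>r. g r a) (\<lambda>r. g r b)" for a b
    by (rule symp_form_eqI[where i=i and j=i and x=0])
       (use assms in \<open>auto simp: opC_def algebra_simps\<close>)
  then show "opC n i t g \<in> Sp n"
    using g assms by (auto simp: Sp_iff supp_mat_def opC_def)
qed

lemma symp_op_opD: assumes "\<forall>i<n. h i \<noteq> 0" shows "symp_op n (opD n h)"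
  unfolding symp_op_def
proof (intro ballI conjI)
  fix g :: "'a mat2" assume g: "g \<in> Sp n"
  show "mmul n (opD n h (mid n)) g = opD n h g"
    using mid_mult_sum[OF Sp_supp[OF g]]
    by (auto simp: mmul_def opD_def fun_eq_iff mult.assoc simp flip: sum_distrib_left)
  have "symp_form n (\<lambda>r. opD n h g r a) (\<lambda>r. opD n h g r b) = symp_form n (\<lambda>r. g r a) (\<lambda>r. g r b)" for a b
    unfolding symp_form_def
    by (rule sum.cong) (use assms in \<open>auto simp: opD_def field_simps\<close>)
  then show "opD n h g \<in> Sp n"
    using g assms by (auto simp: Sp_iff supp_mat_def opD_def)
qed

lemma symp_op_opS: assumes "i < n" shows "symp_op n (opS n i)"
  unfolding symp_op_def
proof (intro ballI conjI)
  fix g :: "'a mat2" assume g: "g \<in> Sp n"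
  show "mmul n (opS n i (mid n)) g = opS n i g"
    using mid_mult_sum[OF Sp_supp[OF g]]
    by (auto simp: mmul_def opS_def fun_eq_iff)
  have "symp_form n (\<lambda>r. opS n i g r a) (\<lambda>r. opS n i g r b) = symp_form n (\<lambda>r. g r a) (\<lambda>r. g r b)" for a b
    by (rule symp_form_eqI[where i=i and j=0
        and x="(g 0 a * g n b - g n a * g 0 b) - (g i a * g (i+n) b - g (i+n) a * g i b)"])
       (use assms in \<open>auto simp: opS_def algebra_simps\<close>)
  then show "opS n i g \<in> Sp n"
    using g assms by (auto simp: Sp_iff supp_mat_def opS_def)
qed

lemma symp_op_opW: assumes "n \<ge> 1" "s * s = 1" shows "symp_op n (opW n s)"
  unfolding symp_op_def
proof (intro ballI conjI)
  fix g :: "'a mat2" assume g: "g \<in> Sp n"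
  show "mmul n (opW n s (mid n)) g = opW n s g"
    using mid_mult_sum[OF Sp_supp[OF g]]
    by (auto simp: mmul_def opW_def fun_eq_iff mult.assoc sum_negf simp flip: sum_distrib_left)
  have *: "s * (s * x) = x" for x using assms(2) by (metis mult.assoc mult_1)
  have "symp_form n (\<lambda>r. opW n s g r a) (\<lambda>r. opW n s g r b) = symp_form n (\<lambda>r. g r a) (\<lambda>r. g r b)" for a b
    by (rule symp_form_eqI[where i=0 and j=0 and x="0"])
       (use assms in \<open>auto simp: opW_def * algebra_simps\<close>)
  then show "opW n s g \<in> Sp n"
    using g assms by (auto simp: Sp_iff supp_mat_def opW_def)
qed

lemma torus_elt_eq_opD: "torus_elt n h = opD n h (mid n)"
  by (auto simp: torus_elt_def opD_def mid_def fun_eq_iff)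

section \<open>Simple root subgroups, coroots and characters of the torus\<close>

definition xp :: "nat \<Rightarrow> nat \<Rightarrow> 'a::comm_ring_1 \<Rightarrow> 'a mat2 \<Rightarrow> 'a mat2" where
  "xp n k t = (if k + 1 < n then opA n k (k+1) t else opB n k t)"

definition xm :: "nat \<Rightarrow> nat \<Rightarrow> 'a::comm_ring_1 \<Rightarrow> 'a mat2 \<Rightarrow> 'a mat2" where
  "xm n k t = (if k + 1 < n then opA n (k+1) k t else opC n k t)"

definition sroot :: "nat \<Rightarrow> nat \<Rightarrow> nat \<Rightarrow> int" where
  "sroot n k = (\<lambda>j. if k + 1 < n then (if j = k then 1 else if j = k+1 then -1 else 0)
     else (if j = k then 2 else 0))"

text \<open>Pairing with the simple coroot. The long case carries no factor 2 because the coroot of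
  2\<epsilon> is \<epsilon>.\<close>

definition pairing :: "nat \<Rightarrow> nat \<Rightarrow> (nat \<Rightarrow> int) \<Rightarrow> int" where
  "pairing n k \<mu> = (if k + 1 < n then \<mu> k - \<mu> (k+1) else \<mu> k)"

definition coroot :: "nat \<Rightarrow> nat \<Rightarrow> 'a::field \<Rightarrow> nat \<Rightarrow> 'a" where
  "coroot n k c = (\<lambda>j. if j = k then c else if k + 1 < n \<and> j = k+1 then inverse c else 1)"

lemma symp_op_xp: "k < n \<Longrightarrow> symp_op n (xp n k t)"
  and symp_op_xm: "k < n \<Longrightarrow> symp_op n (xm n k t)"
  by (auto simp: xp_def xm_def symp_op_opA symp_op_opB symp_op_opC)

lemma xp_0: "xp n k 0 g = g" and xm_0: "xm n k 0 g = g"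
  by (auto simp: xp_def xm_def opA_def opB_def opC_def fun_eq_iff)

lemma xp_add: "k < n \<Longrightarrow> xp n k s (xp n k t g) = xp n k (s+t) g"
  and xm_add: "k < n \<Longrightarrow> xm n k s (xm n k t g) = xm n k (s+t) g"
  by (auto simp: xp_def xm_def opA_def opB_def opC_def fun_eq_iff algebra_simps)

text \<open>A difference of two distinct simple roots is never a root, so these root subgroups
  commute.\<close>

lemma xp_xm_commute:
  "k < n \<Longrightarrow> l < n \<Longrightarrow> k \<noteq> l \<Longrightarrow> xp n k s (xm n l t g) = xm n l t (xp n k s g)"
  by (auto simp: xp_def xm_def opA_def opB_def opC_def fun_eq_iff algebra_simps)

text \<open>The Gauss decomposition in SL_2 of an upper times a lower unipotent matrix. Its
  first-order part in \<open>z\<close> will yield the relation [e, f] = h.\<close>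

lemma xp_xm_swap:
  fixes z :: "'a::field"
  assumes "k < n" "1 + z \<noteq> 0" "supp_mat n g"
  shows "xp n k z (xm n k 1 g)
       = xm n k (1 / (1+z)) (opD n (coroot n k (1+z)) (xp n k (z / (1+z)) g))"
proof (intro ext)
  fix r c
  obtain u where u: "z = u - 1" "u \<noteq> 0" "1 + z = u" using assms(2) by (metis add_diff_cancel_left')
  have "g r c = 0" if "r \<ge> 2*n" using that assms by (auto simp: supp_mat_def)
  then show "xp n k z (xm n k 1 g) r c
       = xm n k (1 / (1+z)) (opD n (coroot n k (1+z)) (xp n k (z / (1+z)) g)) r c"
    unfolding u(3) unfolding u(1) using assms(1) u(2)
    by (auto simp: xp_def xm_def opA_def opB_def opC_def opD_def coroot_def field_simps)
qed

lemma character_single: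
  assumes "k < n" and "\<And>j. j < n \<Longrightarrow> j \<noteq> k \<Longrightarrow> h j powi \<mu> j = 1"
  shows "character n \<mu> h = h k powi \<mu> k"
proof -
  have "character n \<mu> h = (\<Prod>i<n. if i = k then h k powi \<mu> k else 1)"
    unfolding character_def by (rule prod.cong) (use assms in auto)
  then show ?thesis using assms by simp
qed

lemma character_pair:
  assumes "k < n" "l < n" "k \<noteq> l" and "\<And>j. j < n \<Longrightarrow> j \<noteq> k \<Longrightarrow> j \<noteq> l \<Longrightarrow> h j powi \<mu> j = 1"
  shows "character n \<mu> h = h k powi \<mu> k * h l powi \<mu> l"
proof -
  have "character n \<mu> h = (\<Prod>i<n. (if i = k then h k powi \<mu> k else 1) * (if i = l then h l powi \<mu> l else 1))"
    unfolding character_def by (rule prod.cong) (use assms in auto)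
  then show ?thesis using assms by (simp add: prod.distrib)
qed

lemma character_add:
  "\<forall>i<n. h i \<noteq> 0 \<Longrightarrow> character n (\<lambda>j. \<mu> j + \<nu> j) h = character n \<mu> h * character n \<nu> h"
  unfolding character_def by (subst prod.distrib[symmetric], rule prod.cong) (auto simp: power_int_add)

lemma character_scale:
  "\<forall>i<n. h i \<noteq> 0 \<Longrightarrow> character n (\<lambda>j. int k * \<mu> j) h = character n \<mu> h ^ k"
  unfolding character_def prod_power_distrib
  by (rule prod.cong) (simp_all add: power_int_mult mult.commute[of "int k"])

lemma character_root:
  assumes "k < n"
  shows "character n (sroot n k) h = (if k + 1 < n then h k * inverse (h (k+1)) else h k * h k)"
proof (cases "k + 1 < n")
  case True
  show ?thesis
    by (subst character_pair[of k n "k+1"]) (use True in \<open>auto simp: sroot_def power_int_minus\<close>)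
next
  case False
  show ?thesis
    by (subst character_single[of k n]) (use False assms in \<open>auto simp: sroot_def power2_eq_square\<close>)
qed

lemma character_uminus: "character n (\<lambda>j. - \<mu> j) h = inverse (character n \<mu> h)"
  unfolding character_def by (simp add: power_int_minus flip: prod_inversef)

lemma opD_xp:
  assumes "k < n" "\<forall>i<n. h i \<noteq> 0"
  shows "opD n h (xp n k t g) = xp n k (character n (sroot n k) h * t) (opD n h g)"
  using assms by (auto simp: character_root xp_def opA_def opB_def opD_def fun_eq_iff field_simps)

lemma opD_xm:
  assumes "k < n" "\<forall>i<n. h i \<noteq> 0"
  shows "opD n h (xm n k t g) = xm n k (character n (\<lambda>j. - sroot n k j) h * t) (opD n h g)"
  using assms by (auto simp: character_uminus character_root xm_def opA_def opC_def opD_def fun_eq_iff field_simps)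

lemma character_coroot:
  assumes "k < n" "c \<noteq> 0"
  shows "character n \<mu> (coroot n k c) = c powi pairing n k \<mu>"
proof (cases "k + 1 < n")
  case True
  show ?thesis
    by (subst character_pair[of k n "k+1"])
       (use True assms in \<open>auto simp: coroot_def pairing_def power_int_diff power_int_inverse divide_inverse\<close>)
next
  case False
  show ?thesis
    by (subst character_single[of k n]) (use False assms in \<open>auto simp: coroot_def pairing_def\<close>)
qed

section \<open>Generation by simple root subgroups\<close>

text \<open>Generation by simple root subgroups, phrased as an induction principle for a property
  \<open>Q\<close>.\<close>

locale sp_invariant =
  fixes n :: nat and Q :: "'a::field mat2 \<Rightarrow> bool"
  assumes Q_mid: "Q (mid n)"
    and Q_xp: "k < n \<Longrightarrow> g \<in> Sp n \<Longrightarrow> Q g \<Longrightarrow> Q (xp n k t g)"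
    and Q_xm: "k < n \<Longrightarrow> g \<in> Sp n \<Longrightarrow> Q g \<Longrightarrow> Q (xm n k t g)"
begin

text \<open>An equivalence and not an implication, because \<open>Q\<close> must be carried back
  from the end of an elimination to its start.\<close>

definition adm :: "('a mat2 \<Rightarrow> 'a mat2) \<Rightarrow> bool" where
  "adm T \<longleftrightarrow> (\<forall>g\<in>Sp n. T g \<in> Sp n \<and> (Q (T g) \<longleftrightarrow> Q g))"

lemma adm_comp: "adm T \<Longrightarrow> adm U \<Longrightarrow> adm (T \<circ> U)"
  by (auto simp: adm_def)

lemma adm_xp: "k < n \<Longrightarrow> adm (xp n k t)"
  unfolding adm_def using Q_xp[of k _ t] Q_xp[of k "xp n k t _" "-t"] symp_op_xp[of k n t]
  by (auto simp: symp_op_def xp_add xp_0)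

lemma adm_xm: "k < n \<Longrightarrow> adm (xm n k t)"
  unfolding adm_def using Q_xm[of k _ t] Q_xm[of k "xm n k t _" "-t"] symp_op_xm[of k n t]
  by (auto simp: symp_op_def xm_add xm_0)

text \<open>Root subgroups for pairs at distance greater than 1 arise as commutators with those of
  adjacent pairs, which are simple.\<close>

lemma adm_opA_less:
  assumes "i < j" "j < n"
  shows "adm (opA n i j t) \<and> adm (opA n j i t)"
  using assms
proof (induction j arbitrary: t)
  case (Suc j)
  have adj: "adm (opA n j (Suc j) t)" "adm (opA n (Suc j) j t)" for t
    using adm_xp[of j t] adm_xm[of j t] Suc.prems by (auto simp: xp_def xm_def)
  show ?case
  proof (cases "i = j")
    case True
    then show ?thesis using adj by simp
  next
    case False
    with Suc have ij: "i < j" and IH: "adm (opA n i j t)" "adm (opA n j i t)" for t by auto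
    have neq: "i < n" "j < n" "Suc j < n" "i \<noteq> j" "i \<noteq> Suc j" using ij Suc.prems by auto
    have 1: "opA n i (Suc j) t = opA n i j t \<circ> opA n j (Suc j) 1 \<circ> opA n i j (-t) \<circ> opA n j (Suc j) (-1)"
      (is "_ = ?f") and
      2: "opA n (Suc j) i t = opA n (Suc j) j 1 \<circ> opA n j i t \<circ> opA n (Suc j) j (-1) \<circ> opA n j i (-t)"
      (is "_ = ?h")
    proof -
      have "opA n i (Suc j) t g r c = ?f g r c \<and> opA n (Suc j) i t g r c = ?h g r c" for g r c
      proof -
        consider "r = i" | "r = j" | "r = Suc j" | "r = i+n" | "r = j+n" | "r = Suc j+n"
          | "r \<notin> {i, j, Suc j, i+n, j+n, Suc j+n}" by blast
        then show ?thesis using neq by cases (simp_all add: opA_def algebra_simps)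
      qed
      then show "opA n i (Suc j) t = ?f" "opA n (Suc j) i t = ?h" by (auto simp: fun_eq_iff)
    qed
    show ?thesis unfolding 1 2 by (intro conjI adm_comp adj IH)
  qed
qed simp

lemma adm_opA: "i < n \<Longrightarrow> j < n \<Longrightarrow> i \<noteq> j \<Longrightarrow> adm (opA n i j t)"
  using adm_opA_less[of i j t] adm_opA_less[of j i t] by (cases "i < j") auto

text \<open>Conjugation by the Weyl element exchanging two neighbouring coordinates moves
  the long root subgroups from the last coordinate to all others.\<close>
lemma adm_opBC: "i < n \<Longrightarrow> adm (opB n i t) \<and> adm (opC n i t)"
proof (induction "n - i" arbitrary: i t)
  case (Suc d)
  show ?case
  proof (cases "Suc i < n")
    case False
    then show ?thesis using adm_xp[of i t] adm_xm[of i t] Suc.prems by (auto simp: xp_def xm_def)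
  next
    case True
    then have IH: "adm (opB n (Suc i) t)" "adm (opC n (Suc i) t)" using Suc(1)[of "Suc i" t] Suc(2) by auto
    define w :: "'a \<Rightarrow> 'a mat2 \<Rightarrow> 'a mat2" where "w s = opA n i (Suc i) s \<circ> opA n (Suc i) i (-s) \<circ> opA n i (Suc i) s" for s
    have w: "adm (w s)" for s
      unfolding w_def using True by (intro adm_comp adm_opA) auto
    have 1: "opB n i t = w (-1) \<circ> opB n (Suc i) t \<circ> w 1" (is "_ = ?f")
      and 2: "opC n i t = w (-1) \<circ> opC n (Suc i) t \<circ> w 1" (is "_ = ?h")
    proof -
      have "opB n i t g r c = ?f g r c \<and> opC n i t g r c = ?h g r c" for g r c
      proof -
        consider "r = i" | "r = Suc i" | "r = i+n" | "r = Suc i+n" | "r \<notin> {i, Suc i, i+n, Suc i+n}" by blast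
        then show ?thesis using True
          by cases (simp_all add: w_def opA_def opB_def opC_def algebra_simps)
      qed
      then show "opB n i t = ?f" "opC n i t = ?h" by (auto simp: fun_eq_iff)
    qed
    show ?thesis unfolding 1 2 by (intro conjI adm_comp IH w)
  qed
qed simp

lemmas adm_opB = adm_opBC[THEN conjunct1] and adm_opC = adm_opBC[THEN conjunct2]

text \<open>Represents the reflection in the long root 2\<epsilon>_i.\<close>

definition opX :: "nat \<Rightarrow> 'a mat2 \<Rightarrow> 'a mat2" where
  "opX i g = (\<lambda>r c. if r = i then g (i+n) c else if r = i + n then - g i c else g r c)"

lemma adm_opX: assumes "i < n" shows "adm (opX i)"
proof -
  have "opX i = opB n i 1 \<circ> opC n i (-1) \<circ> opB n i 1"
    using assms by (auto simp: fun_eq_iff opX_def opB_def opC_def)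
  then show ?thesis using assms by (auto intro!: adm_comp adm_opB adm_opC)
qed

section \<open>Symplectic Gaussian elimination\<close>

definition reduced :: "nat \<Rightarrow> 'a mat2 \<Rightarrow> bool" where
  "reduced k g \<longleftrightarrow> g \<in> Sp n \<and> (\<forall>j<k. \<forall>r. g r j = mid n r j \<and> g r (j+n) = mid n r (j+n))"

text \<open>One elimination step: an admissible operation that leaves the finished columns alone may
  be applied before proving \<open>Q\<close>.\<close>

lemma adm_reduced:
  assumes "adm T" "reduced k g"
    and "\<And>r j. j < k \<Longrightarrow> T g r j = g r j \<and> T g r (j+n) = g r (j+n)"
    and "reduced k (T g) \<Longrightarrow> Q (T g)"
  shows "Q g"
  using assms unfolding adm_def reduced_def by auto

text \<open>Pairing a unit column with column \<open>c\<close> reads off one entry of column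
  \<open>c\<close>; finished columns thus force finished rows.\<close>

lemma reduced_row:
  assumes "reduced k g" "j < k" "k \<le> n"
  shows "g (j+n) c = Jmat n j c" "g j c = - Jmat n (j+n) c"
proof -
  have *: "symp_form n (\<lambda>r. g r a) (\<lambda>r. g r b) = Jmat n a b" for a b
    using assms by (auto simp: reduced_def Sp_iff)
  have "symp_form n (\<lambda>r. g r j) (\<lambda>r. g r c) = (\<Sum>i<n. if i = j then g (j+n) c else 0)"
    unfolding symp_form_def by (rule sum.cong) (use assms in \<open>auto simp: reduced_def mid_def\<close>)
  then show "g (j+n) c = Jmat n j c" using * assms by simp
  have "symp_form n (\<lambda>r. g r (j+n)) (\<lambda>r. g r c) = (\<Sum>i<n. if i = j then - g j c else 0)"
    unfolding symp_form_def by (rule sum.cong) (use assms in \<open>auto simp: reduced_def mid_def\<close>)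
  then have "- g j c = Jmat n (j+n) c" using * assms by simp
  then show "g j c = - Jmat n (j+n) c" by (metis minus_minus)
qed

lemma reduced_outside:
  assumes "reduced k g" "j < k" "k \<le> n"
  shows "k \<le> c \<Longrightarrow> c < n \<Longrightarrow> g j c = 0 \<and> g (j+n) c = 0 \<and> g j (c+n) = 0 \<and> g (j+n) (c+n) = 0"
  using assms by (simp add: reduced_row Jmat_def)

lemma unit_columnI:
  assumes "reduced k g" "k < n" "c = k \<or> c = k + n"
    and "\<And>i. k \<le> i \<Longrightarrow> i < n \<Longrightarrow> g i c = mid n i c \<and> g (i+n) c = mid n (i+n) c"
  shows "g r c = mid n r c"
proof (cases rule: less_double_cases[of r n])
  case 1
  then show ?thesis using assms reduced_outside[OF assms(1), of r k]
    by (cases "k \<le> r") (auto simp: mid_def)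
next
  case (2 i)
  then show ?thesis using assms reduced_outside[OF assms(1), of i k]
    by (cases "k \<le> i") (auto simp: mid_def)
next
  case 3
  then show ?thesis using assms(1) by (auto simp: reduced_def Sp_iff supp_mat_def mid_def)
qed

section \<open>Clearing columns \<open>k\<close> and \<open>k+n\<close>, with the stages in reverse
  order of use\<close>

context
  fixes k assumes k: "k < n" and IH: "\<And>g. reduced (Suc k) g \<Longrightarrow> Q g"
begin

lemma dual_entry:
  assumes "reduced k g" "\<And>r. g r k = mid n r k"
  shows "g (k+n) (k+n) = 1"
proof -
  have "symp_form n (\<lambda>r. g r k) (\<lambda>r. g r (k+n)) = (\<Sum>i<n. if i = k then g (k+n) (k+n) else 0)"
    unfolding symp_form_def by (rule sum.cong) (use assms(2) k in \<open>auto simp: mid_def\<close>)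
  moreover have "symp_form n (\<lambda>r. g r k) (\<lambda>r. g r (k+n)) = Jmat n k (k+n)"
    using assms(1) by (auto simp: reduced_def Sp_iff)
  ultimately show ?thesis using k by (simp add: Jmat_def)
qed

text \<open>Clears column \<open>k+n\<close> once column \<open>k\<close> is a unit column, one
  coordinate pair at a time; \<open>l\<close> is the first pair not yet cleared.\<close>

lemma Q_dual_column:
  assumes "l \<le> n" "k < l" "reduced k g" "\<And>r. g r k = mid n r k"
    and "\<And>i. k < i \<Longrightarrow> i < l \<Longrightarrow> g i (k+n) = 0 \<and> g (i+n) (k+n) = 0"
  shows "Q g"
  using assms
proof (induction l arbitrary: g rule: inc_induct)
  case base
  note kk = dual_entry[OF base(2,3)]
  show ?case
  proof (rule adm_reduced[OF adm_opB[OF k, of "- g k (k+n)"] base(2)])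
    fix r j assume "j < k"
    then show "opB n k (- g k (k + n)) g r j = g r j \<and> opB n k (- g k (k + n)) g r (j + n) = g r (j + n)"
      using base(2) k by (auto simp: opB_def reduced_def mid_def)
  next
    let ?h = "opB n k (- g k (k + n)) g"
    assume h: "reduced k ?h"
    have "?h r k = mid n r k" for r
      using base(3) k by (auto simp: opB_def mid_def)
    moreover have "?h r (k+n) = mid n r (k+n)" for r
      by (rule unit_columnI[OF h k]) (use base kk k in \<open>auto simp: opB_def mid_def le_less\<close>)
    ultimately have "reduced (Suc k) ?h" using h by (auto simp: reduced_def less_Suc_eq)
    then show "Q ?h" by (rule IH)
  qed
next
  case (step l)
  note kk = dual_entry[OF step(5,6)]
  have l: "l < n" "k < l" using step by auto
  \<comment> \<open>\<open>opA n k l\<close> clears only the lower entry of pair \<open>l\<close>,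
    using the 1 in row \<open>k+n\<close>. \<open>opX\<close> then moves the upper entry, with a
    sign, to the lower place, and it is cleared in the same way. Column \<open>k\<close> is zero in
    the rows that are added or exchanged.\<close>
  define T where "T = opA n k l (- g l (k+n)) \<circ> opX l \<circ> opA n k l (g (l+n) (k+n))"
  have "adm T" unfolding T_def using k l by (intro adm_comp adm_opA adm_opX) auto
  show ?case
  proof (rule adm_reduced[OF \<open>adm T\<close> step(5)])
    fix r j assume "j < k"
    then show "T g r j = g r j \<and> T g r (j + n) = g r (j + n)"
      using step(5) k l by (auto simp: T_def opA_def opX_def reduced_def mid_def)
  next
    assume h: "reduced k (T g)"
    have 1: "T g r k = mid n r k" for r
      using step(6) k l by (auto simp: T_def opA_def opX_def mid_def)
    show "Q (T g)"
      by (rule step.IH[OF _ h 1])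
        (use step(7) kk k l in \<open>auto simp: T_def opA_def opX_def less_Suc_eq\<close>)
  qed
qed

text \<open>The 1 in row \<open>k+n\<close> is an auxiliary pivot for clearing the lower half of
  column \<open>k\<close>; it is itself removed at the end by the pivot in row
  \<open>k\<close>.\<close>

lemma Q_lower_column:
  assumes "l \<le> n" "k < l" "reduced k g" "g k k = 1" "g (k+n) k = 1"
    and "\<And>i. k < i \<Longrightarrow> i < n \<Longrightarrow> g i k = 0"
    and "\<And>i. k < i \<Longrightarrow> i < l \<Longrightarrow> g (i+n) k = 0"
  shows "Q g"
  using assms
proof (induction l arbitrary: g rule: inc_induct)
  case base
  show ?case
  proof (rule adm_reduced[OF adm_opC[OF k, of "- 1"] base(2)])
    fix r j assume "j < k"
    then show "opC n k (- 1) g r j = g r j \<and> opC n k (- 1) g r (j + n) = g r (j + n)"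
      using base(2) k by (auto simp: opC_def reduced_def mid_def)
  next
    let ?h = "opC n k (- 1) g"
    assume h: "reduced k ?h"
    have "?h r k = mid n r k" for r
      by (rule unit_columnI[OF h k]) (use base k in \<open>auto simp: opC_def mid_def le_less\<close>)
    then show "Q ?h" using Q_dual_column[of "Suc k" ?h] k h by auto
  qed
next
  case (step l)
  have l: "l < n" "k < l" using step by auto
  let ?h = "opA n k l (g (l+n) k) g"
  have "adm (opA n k l (g (l+n) k))" using k l by (intro adm_opA) auto
  show ?case
  proof (rule adm_reduced[OF \<open>adm _\<close> step(5)])
    fix r j assume "j < k"
    then show "?h r j = g r j \<and> ?h r (j + n) = g r (j + n)"
      using step(5) k l by (auto simp: opA_def reduced_def mid_def)
  next
    assume h: "reduced k ?h"
    show "Q ?h"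
      by (rule step.IH[OF _ h]) (use step k l in \<open>auto simp: opA_def less_Suc_eq\<close>)
  qed
qed

text \<open>Clearing the upper half with the pivot in row \<open>k\<close> disturbs the entry in row
  \<open>k+n\<close>. This does no harm, since that entry is finally set to the 1 needed by the next
  stage.\<close>

lemma Q_upper_column:
  assumes "l \<le> n" "k < l" "reduced k g" "g k k = 1"
    and "\<And>i. k < i \<Longrightarrow> i < l \<Longrightarrow> g i k = 0"
  shows "Q g"
  using assms
proof (induction l arbitrary: g rule: inc_induct)
  case base
  let ?h = "opC n k (1 - g (k+n) k) g"
  show ?case
  proof (rule adm_reduced[OF adm_opC[OF k] base(2)])
    fix r j assume "j < k"
    then show "?h r j = g r j \<and> ?h r (j + n) = g r (j + n)"
      using base(2) k by (auto simp: opC_def reduced_def mid_def)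
  next
    assume h: "reduced k ?h"
    show "Q ?h"
      by (rule Q_lower_column[of "Suc k", OF _ _ h]) (use base k in \<open>auto simp: opC_def\<close>)
  qed
next
  case (step l)
  have l: "l < n" "k < l" using step by auto
  let ?h = "opA n l k (- g l k) g"
  have "adm (opA n l k (- g l k))" using k l by (intro adm_opA) auto
  show ?case
  proof (rule adm_reduced[OF \<open>adm _\<close> step(5)])
    fix r j assume "j < k"
    then show "?h r j = g r j \<and> ?h r (j + n) = g r (j + n)"
      using step(5) k l by (auto simp: opA_def reduced_def mid_def)
  next
    assume h: "reduced k ?h"
    show "Q ?h"
      by (rule step.IH[OF _ h]) (use step k l in \<open>auto simp: opA_def less_Suc_eq\<close>)
  qed
qed

lemma Q_pivot:
  assumes "reduced k g" "g k k \<noteq> 0"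
  shows "Q g"
proof -
  \<comment> \<open>\<open>opC\<close> first makes the entry in row \<open>k+n\<close> equal to 1;
    \<open>opB\<close> then uses it to turn the pivot into 1.\<close>
  define T where "T = opB n k (1 - g k k) \<circ> opC n k ((1 - g (k+n) k) / g k k)"
  have "adm T" unfolding T_def using k by (intro adm_comp adm_opB adm_opC) auto
  show ?thesis
  proof (rule adm_reduced[OF \<open>adm T\<close> assms(1)])
    fix r j assume "j < k"
    then show "T g r j = g r j \<and> T g r (j + n) = g r (j + n)"
      using assms k by (auto simp: T_def opB_def opC_def reduced_def mid_def)
  next
    assume h: "reduced k (T g)"
    show "Q (T g)"
      by (rule Q_upper_column[of "Suc k", OF _ _ h]) (use assms k in \<open>auto simp: T_def opB_def opC_def\<close>)
  qed
qed

lemma Q_upper_pivot: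
  assumes "reduced k g" "k \<le> i" "i < n" "g i k \<noteq> 0"
  shows "Q g"
proof (cases "g k k = 0")
  case True
  with assms have i: "k \<noteq> i" by auto
  let ?h = "opA n k i 1 g"
  show ?thesis
  proof (rule adm_reduced[OF adm_opA[OF k assms(3) i] assms(1)])
    fix r j assume "j < k"
    then show "?h r j = g r j \<and> ?h r (j + n) = g r (j + n)"
      using assms k by (auto simp: opA_def reduced_def mid_def)
  next
    assume h: "reduced k ?h"
    show "Q ?h"
      by (rule Q_pivot[OF h]) (use assms True in \<open>auto simp: opA_def\<close>)
  qed
qed (use Q_pivot assms in auto)

lemma Q_reduced_step:
  assumes "reduced k g"
  shows "Q g"
proof (cases "\<exists>i. k \<le> i \<and> i < n \<and> g i k \<noteq> 0")
  case False
  \<comment> \<open>Column \<open>k\<close> cannot vanish, since its form with column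
    \<open>k+n\<close> is 1.\<close>
  have "\<exists>i. k \<le> i \<and> i < n \<and> g (i+n) k \<noteq> 0"
  proof (rule ccontr)
    assume "\<not> ?thesis"
    with False have "g i k = 0 \<and> g (i+n) k = 0" if "i < n" for i
      using that reduced_outside[OF assms, of i k] k by (cases "k \<le> i") auto
    then have "symp_form n (\<lambda>r. g r k) (\<lambda>r. g r (k+n)) = 0"
      by (simp add: symp_form_def)
    moreover have "symp_form n (\<lambda>r. g r k) (\<lambda>r. g r (k+n)) = Jmat n k (k+n)"
      using assms by (auto simp: reduced_def Sp_iff)
    ultimately show False using k by (simp add: Jmat_def)
  qed
  then obtain i where i: "k \<le> i" "i < n" "g (i+n) k \<noteq> 0" by blast
  let ?h = "opB n i 1 g"
  show ?thesis
  proof (rule adm_reduced[OF adm_opB[OF i(2)] assms])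
    fix r j assume "j < k"
    then show "?h r j = g r j \<and> ?h r (j + n) = g r (j + n)"
      using assms k i by (auto simp: opB_def reduced_def mid_def)
  next
    assume h: "reduced k ?h"
    show "Q ?h"
      by (rule Q_upper_pivot[OF h i(1,2)]) (use False i in \<open>auto simp: opB_def\<close>)
  qed
qed (use Q_upper_pivot assms in auto)

end

theorem Q_Sp: assumes "g \<in> Sp n" shows "Q g"
proof -
  \<comment> \<open>Downward induction: for \<open>k = n\<close> only the identity is left, and for
    \<open>k = 0\<close> being reduced just means membership in the group.\<close>
  have "Q g" if "k \<le> n" "reduced k g" for k g
    using that
  proof (induction k arbitrary: g rule: inc_induct)
    case base
    have "g = mid n"
    proof (intro ext)
      fix r c show "g r c = mid n r c"
        by (cases rule: less_double_cases[of c n])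
          (use base in \<open>auto simp: reduced_def Sp_iff supp_mat_def mid_def\<close>)
    qed
    then show ?case using Q_mid by simp
  next
    case (step k)
    then show ?case using Q_reduced_step[of k g] by auto
  qed
  from this[of 0 g] show ?thesis using assms by (auto simp: reduced_def)
qed

end

section \<open>Polynomials and characters over infinite fields\<close>

text \<open>Over a finite field, 1 plus the product of all \<open>X - a\<close> would be a
  nonconstant polynomial without roots.\<close>

lemma alg_closed_infinite:
  assumes "alg_closed TYPE('a::field)"
  shows "infinite (UNIV :: 'a set)"
proof
  assume fin: "finite (UNIV :: 'a set)"
  define q :: "'a poly" where "q = (\<Prod>a\<in>UNIV. [:-a, 1:]) + 1"
  have q: "poly q x = 1" for x
    unfolding q_def poly_add poly_prod using fin by (auto intro!: prod_zero)
  have "degree q \<noteq> 0"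
  proof
    assume "degree q = 0"
    then obtain c where c: "q = [:c:]" by (metis degree_eq_zeroE)
    then have "q = 1" using q[of 0] by simp
    then have "(\<Prod>a\<in>UNIV. [:-a, 1::'a:]) = 0" by (simp add: q_def)
    then show False using fin by (simp add: prod_zero_iff)
  qed
  then obtain x where "poly q x = 0" using assms by (auto simp: alg_closed_def)
  with q show False by simp
qed

text \<open>The exceptional set accommodates identities with denominators, known only for nonzero
  \<open>z\<close> or \<open>1 + z\<close>.\<close>

lemma poly_eqI_cofinite:
  fixes p q :: "'a::idom poly"
  assumes "infinite (UNIV :: 'a set)" "finite A" "\<And>x. x \<notin> A \<Longrightarrow> poly p x = poly q x"
  shows "p = q"
proof (rule ccontr)
  assume "p \<noteq> q"
  then have "finite {x. poly (p - q) x = 0}" by (intro poly_roots_finite) auto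
  moreover have "UNIV \<subseteq> A \<union> {x. poly (p - q) x = 0}" using assms(3) by auto
  ultimately show False using assms(1,2) by (metis finite_UnI finite_subset)
qed

definition vpoly :: "nat \<Rightarrow> (nat \<Rightarrow> 'a::field ^ 'd) \<Rightarrow> 'd \<Rightarrow> 'a poly" where
  "vpoly D u c = (\<Sum>k<D. monom (u k $ c) k)"

lemma poly_vpoly: "poly (vpoly D u c) t = (\<Sum>k<D. t ^ k *s u k) $ c"
  by (simp add: vpoly_def poly_sum poly_monom mult.commute)

lemma coeff_vpoly: "coeff (vpoly D u c) k = (if k < D then u k $ c else 0)"
  by (simp add: vpoly_def coeff_sum)

text \<open>Turns an identity between one-parameter subgroups into relations between their
  coefficients.\<close>

lemma vec_poly_eqD:
  fixes u w :: "nat \<Rightarrow> 'a::field ^ 'd"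
  assumes "infinite (UNIV :: 'a set)"
    and "\<And>t. (\<Sum>k<D. t ^ k *s u k) = (\<Sum>k<D. t ^ k *s w k)" and "k < D"
  shows "u k = w k"
proof -
  have "vpoly D u c = vpoly D w c" for c
    by (rule poly_eqI_cofinite[OF assms(1), of "{}"]) (simp_all add: poly_vpoly assms(2))
  then have "coeff (vpoly D u c) k = coeff (vpoly D w c) k" for c by simp
  then show ?thesis using assms(3) by (simp add: coeff_vpoly vec_eq_iff)
qed

section \<open>Linear independence of the characters of the torus\<close>

lemma power_int_separates:
  fixes a b :: int
  assumes "infinite (UNIV :: 'a::field set)" "a \<noteq> b"
  shows "\<exists>z::'a. z \<noteq> 0 \<and> z powi a \<noteq> z powi b"
proof -
  have *: "\<exists>z::'a. z \<noteq> 0 \<and> z powi a \<noteq> z powi b" if "a < b" for a b :: int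
  proof (rule ccontr)
    assume "\<not> ?thesis"
    then have h: "z powi a = z powi b" if "z \<noteq> 0" for z :: 'a using that by auto
    have "z ^ nat (b - a) = 1" if "z \<noteq> 0" for z :: 'a
      using h[OF that] that \<open>a < b\<close> by (simp flip: power_int_of_nat add: power_int_diff)
    then have "monom 1 (nat (b - a)) = (1 :: 'a poly)"
      by (intro poly_eqI_cofinite[OF assms(1), of "{0}"]) (auto simp: poly_monom)
    then have "degree (monom (1::'a) (nat (b - a))) = 0" by simp
    then show False using that by (simp add: degree_monom_eq)
  qed
  show ?thesis using *[of a b] *[of b a] assms(2) by (cases "a < b") force+
qed

lemma character_mult:
  "character n \<mu> (\<lambda>i. s i * t i) = character n \<mu> s * character n \<mu> t"
  by (simp add: character_def power_int_mult_distrib prod.distrib)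

lemma characters_separate:
  fixes \<mu> \<nu> :: "nat \<Rightarrow> int"
  assumes "infinite (UNIV :: 'a::field set)" "\<mu> \<noteq> \<nu>" "\<forall>j\<ge>n. \<mu> j = 0" "\<forall>j\<ge>n. \<nu> j = 0"
  shows "\<exists>s::nat \<Rightarrow> 'a. (\<forall>i<n. s i \<noteq> 0) \<and> character n \<mu> s \<noteq> character n \<nu> s"
proof -
  obtain j where j: "\<mu> j \<noteq> \<nu> j" using assms(2) by auto
  with assms have "j < n" by (metis linorder_not_less)
  obtain z :: 'a where z: "z \<noteq> 0" "z powi \<mu> j \<noteq> z powi \<nu> j" using power_int_separates[OF assms(1) j] by blast
  have "character n \<eta> (\<lambda>i. if i = j then z else 1) = z powi \<eta> j" for \<eta>
    by (subst character_single[OF \<open>j < n\<close>]) auto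
  with z show ?thesis by (intro exI[of _ "\<lambda>i. if i = j then z else 1"]) auto
qed

text \<open>Dedekind's argument: translating the relation by \<open>s\<close> and subtracting a
  multiple of it removes one character and keeps a chosen other one with a nonzero factor.\<close>

lemma characters_independent:
  fixes c :: "(nat \<Rightarrow> int) \<Rightarrow> 'a::field"
  assumes inf: "infinite (UNIV :: 'a set)" and "finite F" "\<forall>\<eta>\<in>F. \<forall>j\<ge>n. \<eta> j = 0"
    and "\<And>t. \<forall>i<n. t i \<noteq> 0 \<Longrightarrow> (\<Sum>\<eta>\<in>F. c \<eta> * character n \<eta> t) = 0" and "\<eta> \<in> F"
  shows "c \<eta> = 0"
  using assms(2-)
proof (induction F arbitrary: c \<eta> rule: finite_induct)
  case (insert \<psi> F)
  have F: "c \<eta> = 0" if in_F: "\<eta> \<in> F" for \<eta>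
  proof -
    obtain s :: "nat \<Rightarrow> 'a" where s: "\<forall>i<n. s i \<noteq> 0" "character n \<eta> s \<noteq> character n \<psi> s"
    proof -
      have "\<eta> \<noteq> \<psi>" "\<forall>j\<ge>n. \<eta> j = 0" "\<forall>j\<ge>n. \<psi> j = 0"
        using in_F insert.hyps insert.prems(1) by auto
      from characters_separate[OF inf this] show ?thesis using that by blast
    qed
    have "c \<eta> * (character n \<eta> s - character n \<psi> s) = 0"
    proof (rule insert.IH[OF _ _ in_F])
      fix t :: "nat \<Rightarrow> 'a" assume t: "\<forall>i<n. t i \<noteq> 0"
      have "(\<Sum>\<eta>\<in>insert \<psi> F. c \<eta> * character n \<eta> (\<lambda>i. s i * t i)) = 0"
        by (rule insert.prems(2)) (use s t in auto)
      moreover have "character n \<psi> s * (\<Sum>\<eta>\<in>insert \<psi> F. c \<eta> * character n \<eta> t) = 0"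
        using insert.prems(2)[OF t] by simp
      ultimately have "(\<Sum>\<eta>\<in>insert \<psi> F. c \<eta> * character n \<eta> (\<lambda>i. s i * t i)
          - character n \<psi> s * (c \<eta> * character n \<eta> t)) = 0"
        by (simp add: sum_subtractf sum_distrib_left)
      then show "(\<Sum>\<eta>\<in>F. c \<eta> * (character n \<eta> s - character n \<psi> s) * character n \<eta> t) = 0"
        using insert.hyps by (simp add: character_mult algebra_simps)
    qed (use insert.prems in auto)
    then show ?thesis using s by simp
  qed
  have "c \<psi> * character n \<psi> (\<lambda>_. 1) = 0"
    using insert.prems(2)[of "\<lambda>_. 1"] insert.hyps F by simp
  then have "c \<psi> = 0" by (simp add: character_def)
  with F insert.prems show ?case by auto
qed simp

lemma characters_vec_eqD:
  fixes u w :: "(nat \<Rightarrow> int) \<Rightarrow> 'a::field ^ 'd"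
  assumes inf: "infinite (UNIV :: 'a set)" and "finite F" "\<forall>\<eta>\<in>F. \<forall>j\<ge>n. \<eta> j = 0"
    and "\<And>t. \<forall>i<n. t i \<noteq> 0 \<Longrightarrow> (\<Sum>\<eta>\<in>F. character n \<eta> t *s u \<eta>) = (\<Sum>\<eta>\<in>F. character n \<eta> t *s w \<eta>)"
    and "\<eta> \<in> F"
  shows "u \<eta> = w \<eta>"
proof -
  have "u \<eta> $ c - w \<eta> $ c = 0" for c
  proof (rule characters_independent[OF inf assms(2,3) _ assms(5), where c = "\<lambda>\<eta>. u \<eta> $ c - w \<eta> $ c"])
    fix t :: "nat \<Rightarrow> 'a" assume "\<forall>i<n. t i \<noteq> 0"
    from arg_cong[OF assms(4)[OF this], of "\<lambda>v. v $ c"]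
    show "(\<Sum>\<eta>\<in>F. (u \<eta> $ c - w \<eta> $ c) * character n \<eta> t) = 0"
      by (simp add: algebra_simps sum_subtractf)
  qed
  then show ?thesis by (simp add: vec_eq_iff)
qed

section \<open>Laurent polynomials on the torus, polynomials along root subgroups\<close>

text \<open>The functions that arise by restricting polynomial functions to the torus. Labels vanish
  from \<open>n\<close> on, so that over an infinite field distinct labels are distinct
  characters.\<close>

definition laurent :: "nat \<Rightarrow> ((nat \<Rightarrow> 'a::field) \<Rightarrow> 'a) \<Rightarrow> bool" where
  "laurent n f \<longleftrightarrow> (\<exists>F c. finite F \<and> (\<forall>\<eta>\<in>F. \<forall>j\<ge>n. \<eta> j = 0) \<and>
     (\<forall>t. (\<forall>i<n. t i \<noteq> 0) \<longrightarrow> f t = (\<Sum>\<eta>\<in>F. c \<eta> * character n \<eta> t)))"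

lemma laurent_0: "laurent n (\<lambda>t. 0)"
  unfolding laurent_def by (rule exI[of _ "{}"]) auto

lemma laurent_add:
  assumes "laurent n f" "laurent n g" shows "laurent n (\<lambda>t. f t + g t)"
proof -
  obtain F c where F: "finite F" "\<forall>\<eta>\<in>F. \<forall>j\<ge>n. \<eta> j = 0"
    "\<And>t. \<forall>i<n. t i \<noteq> 0 \<Longrightarrow> f t = (\<Sum>\<eta>\<in>F. c \<eta> * character n \<eta> t)"
    using assms(1) unfolding laurent_def by blast
  obtain G d where G: "finite G" "\<forall>\<eta>\<in>G. \<forall>j\<ge>n. \<eta> j = 0"
    "\<And>t. \<forall>i<n. t i \<noteq> 0 \<Longrightarrow> g t = (\<Sum>\<eta>\<in>G. d \<eta> * character n \<eta> t)"
    using assms(2) unfolding laurent_def by blast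
  have "f t + g t = (\<Sum>\<eta>\<in>F\<union>G. ((if \<eta> \<in> F then c \<eta> else 0) + (if \<eta> \<in> G then d \<eta> else 0)) * character n \<eta> t)"
    if t: "\<forall>i<n. t i \<noteq> 0" for t
  proof -
    have "f t = (\<Sum>\<eta>\<in>F\<union>G. (if \<eta> \<in> F then c \<eta> else 0) * character n \<eta> t)"
      unfolding F(3)[OF t] by (rule sum.mono_neutral_cong_left) (use F G in auto)
    moreover have "g t = (\<Sum>\<eta>\<in>F\<union>G. (if \<eta> \<in> G then d \<eta> else 0) * character n \<eta> t)"
      unfolding G(3)[OF t] by (rule sum.mono_neutral_cong_left) (use F G in auto)
    ultimately show ?thesis by (simp add: distrib_right sum.distrib)
  qed
  then show ?thesis unfolding laurent_def
    using F(1,2) G(1,2)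
    by (intro exI[of _ "F \<union> G"] exI[of _ "\<lambda>\<eta>. (if \<eta> \<in> F then c \<eta> else 0) + (if \<eta> \<in> G then d \<eta> else 0)"]) auto
qed

lemma laurent_character_mult:
  assumes "laurent n f" "\<forall>j\<ge>n. \<psi> j = 0"
  shows "laurent n (\<lambda>t. a * character n \<psi> t * f t)"
proof -
  obtain F c where F: "finite F" "\<forall>\<eta>\<in>F. \<forall>j\<ge>n. \<eta> j = 0"
    "\<And>t. \<forall>i<n. t i \<noteq> 0 \<Longrightarrow> f t = (\<Sum>\<eta>\<in>F. c \<eta> * character n \<eta> t)"
    using assms(1) unfolding laurent_def by blast
  define sh where "sh \<eta> = (\<lambda>j. \<eta> j + \<psi> j)" for \<eta> :: "nat \<Rightarrow> int"
  have inj: "inj_on sh F" by (auto simp: inj_on_def sh_def fun_eq_iff)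
  have "a * character n \<psi> t * f t = (\<Sum>\<eta>\<in>sh ` F. a * c (\<lambda>j. \<eta> j - \<psi> j) * character n \<eta> t)"
    if t: "\<forall>i<n. t i \<noteq> 0" for t
    unfolding F(3)[OF t] sum_distrib_left sum.reindex[OF inj]
    by (rule sum.cong) (simp_all add: sh_def character_add[OF t])
  then show ?thesis unfolding laurent_def
    using F(1,2) assms(2)
    by (intro exI[of _ "sh ` F"] exI[of _ "\<lambda>\<eta>. a * c (\<lambda>j. \<eta> j - \<psi> j)"]) (auto simp: sh_def)
qed

lemma laurent_sum: "finite A \<Longrightarrow> (\<And>x. x \<in> A \<Longrightarrow> laurent n (f x)) \<Longrightarrow> laurent n (\<lambda>t. \<Sum>x\<in>A. f x t)"
  by (induction A rule: finite_induct) (auto simp: laurent_0 laurent_add)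

lemma laurent_mult:
  assumes "laurent n f" "laurent n g" shows "laurent n (\<lambda>t. f t * g t)"
proof -
  obtain F c where F: "finite F" "\<forall>\<eta>\<in>F. \<forall>j\<ge>n. \<eta> j = 0"
    "\<And>t. \<forall>i<n. t i \<noteq> 0 \<Longrightarrow> f t = (\<Sum>\<eta>\<in>F. c \<eta> * character n \<eta> t)"
    using assms(1) unfolding laurent_def by blast
  have "laurent n (\<lambda>t. \<Sum>\<eta>\<in>F. c \<eta> * character n \<eta> t * g t)"
    using F assms(2) by (intro laurent_sum laurent_character_mult) auto
  then obtain G d where G: "finite G" "\<forall>\<eta>\<in>G. \<forall>j\<ge>n. \<eta> j = 0"
    "\<And>t. \<forall>i<n. t i \<noteq> 0 \<Longrightarrow> (\<Sum>\<eta>\<in>F. c \<eta> * character n \<eta> t * g t) = (\<Sum>\<eta>\<in>G. d \<eta> * character n \<eta> t)"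
    unfolding laurent_def by blast
  have "f t * g t = (\<Sum>\<eta>\<in>G. d \<eta> * character n \<eta> t)" if t: "\<forall>i<n. t i \<noteq> 0" for t
    using G(3)[OF t] F(3)[OF t] by (simp add: sum_distrib_right)
  then show ?thesis unfolding laurent_def using G(1,2) by blast
qed

lemma laurent_const: "laurent n (\<lambda>t. a)"
  unfolding laurent_def
  by (rule exI[of _ "{\<lambda>_. 0}"], rule exI[of _ "\<lambda>_. a"]) (auto simp: character_def)

lemma laurent_coord:
  assumes "i < n" shows "laurent n (\<lambda>t. t i :: 'a::field)" "laurent n (\<lambda>t. inverse (t i :: 'a))"
proof -
  have "character n (\<lambda>j. if j = i then k else 0) t = t i powi k" for t :: "nat \<Rightarrow> 'a" and k
    by (subst character_single[OF assms]) auto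
  note * = this[of 1] this[of "-1"]
  show "laurent n (\<lambda>t. t i :: 'a)" unfolding laurent_def
    using * assms by (intro exI[of _ "{\<lambda>j. if j = i then 1 else 0}"] exI[of _ "\<lambda>_. 1"]) auto
  show "laurent n (\<lambda>t. inverse (t i :: 'a))" unfolding laurent_def
    using * assms by (intro exI[of _ "{\<lambda>j. if j = i then -1 else 0}"] exI[of _ "\<lambda>_. 1"])
      (auto simp: power_int_minus)
qed

lemma poly_fun_torus: "f \<in> poly_fun n \<Longrightarrow> laurent n (\<lambda>t. f (torus_elt n t))"
proof (induction rule: poly_fun.induct)
  case (pf_coord i j)
  then show ?case
    by (cases "i = j"; cases "i < n") (auto simp: torus_elt_def laurent_0 laurent_coord)
qed (auto simp: laurent_const laurent_add laurent_mult)

lemma poly_fun_curve: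
  assumes "f \<in> poly_fun n" and X: "\<And>r c. \<exists>q. \<forall>t. X t r c = poly q t"
  shows "\<exists>q. \<forall>t. f (X t) = poly q t"
  using assms(1)
proof (induction rule: poly_fun.induct)
  case (pf_const c)
  then show ?case by (intro exI[of _ "[:c:]"]) simp
next
  case (pf_add f h)
  then obtain q q' where "\<forall>t. f (X t) = poly q t" "\<forall>t. h (X t) = poly q' t" by blast
  then show ?case by (intro exI[of _ "q + q'"]) simp
next
  case (pf_mult f h)
  then obtain q q' where "\<forall>t. f (X t) = poly q t" "\<forall>t. h (X t) = poly q' t" by blast
  then show ?case by (intro exI[of _ "q * q'"]) simp
qed (use X in auto)

lemma opA_poly: "\<exists>q. \<forall>t. opA n i j t g r c = poly q t"
  by (cases "r = i"; cases "r = j + n")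
    (auto simp: opA_def intro: exI[of _ "[:g i c, g j c:]"] exI[of _ "[:g (j+n) c, - g (i+n) c:]"] exI[of _ "[:g r c:]"])

lemma opB_poly: "\<exists>q. \<forall>t. opB n i t g r c = poly q t"
  by (cases "r = i") (auto simp: opB_def intro: exI[of _ "[:g i c, g (i+n) c:]"] exI[of _ "[:g r c:]"])

lemma opC_poly: "\<exists>q. \<forall>t. opC n i t g r c = poly q t"
  by (cases "r = i+n") (auto simp: opC_def intro: exI[of _ "[:g (i+n) c, g i c:]"] exI[of _ "[:g r c:]"])

lemma xp_poly: "\<exists>q. \<forall>t. xp n k t g r c = poly q t"
  and xm_poly: "\<exists>q. \<forall>t. xm n k t g r c = poly q t"
  by (cases "k + 1 < n"; simp add: xp_def xm_def opA_poly opB_poly opC_poly)+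

section \<open>Rational representations\<close>

lemma matrix_vector_mult_sum: "A *v (\<Sum>k\<in>S. f k) = (\<Sum>k\<in>S. A *v f k)" for A :: "'a::field ^ 'n ^ 'm"
  by (induction S rule: infinite_finite_induct) (simp_all add: matrix_vector_right_distrib)

lemma matrix_vector_mult_smult: "A *v (c *s v) = c *s (A *v v)" for A :: "'a::field ^ 'n ^ 'm"
  by (simp add: vector_scalar_commute)

lemma vec_sum_smult: "c *s (\<Sum>k\<in>S. f k) = (\<Sum>k\<in>S. c *s f k)" for f :: "_ \<Rightarrow> 'a::field ^ 'n"
  by (rule vec.scale_sum_right)

lemma coeff_mult_1: "coeff (p * q) 1 = coeff p 0 * coeff q 1 + coeff p 1 * coeff q 0"
  by (simp add: coeff_mult)

lemma coeff_linear_power: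
  "coeff ([:1, 1::'a::comm_ring_1:] ^ M) 0 = 1" "coeff ([:1, 1::'a:] ^ M) 1 = of_nat M"
  by (induction M) (simp_all add: coeff_mult_1 coeff_mult del: mult_pCons_left)

locale rational_sp_rep =
  fixes n :: nat and \<rho> :: "'a::field mat2 \<Rightarrow> 'a^'d^'d"
  assumes rational: "rational_rep n \<rho>" and infinite_field: "infinite (UNIV :: 'a set)"
begin

abbreviation V where "V \<equiv> weight_space n \<rho>"

lemma rho_mid: "\<rho> (mid n) = mat 1"
  using rational by (simp add: rational_rep_def)

lemma rho_op: "symp_op n T \<Longrightarrow> g \<in> Sp n \<Longrightarrow> \<rho> (T g) *v v = \<rho> (T (mid n)) *v (\<rho> g *v v)"
proof -
  assume T: "symp_op n T" and g: "g \<in> Sp n"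
  have "T (mid n) \<in> Sp n" "mmul n (T (mid n)) g = T g"
    using T g mid_in_Sp by (auto simp: symp_op_def)
  then have "\<rho> (T g) = \<rho> (T (mid n)) ** \<rho> g"
    using rational g unfolding rational_rep_def by metis
  then show ?thesis by (simp add: matrix_vector_mul_assoc)
qed

lemma op_mid_in_Sp: "symp_op n T \<Longrightarrow> T (mid n) \<in> Sp n"
  using mid_in_Sp by (auto simp: symp_op_def)

lemma weight_spaceD: "v \<in> V \<mu> \<Longrightarrow> \<forall>i<n. t i \<noteq> 0 \<Longrightarrow> \<rho> (torus_elt n t) *v v = character n \<mu> t *s v"
  by (simp add: weight_space_def)

lemma subspace_weight_space: "vec.subspace (V \<mu>)"
  unfolding vec.subspace_def weight_space_def
  by (auto simp: matrix_vector_right_distrib vector_add_ldistrib matrix_vector_mult_smult vector_smult_assoc mult.commute)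

lemma rho_torus_mult:
  assumes "\<forall>i<n. s i \<noteq> 0" "\<forall>i<n. t i \<noteq> 0"
  shows "\<rho> (torus_elt n s) *v (\<rho> (torus_elt n t) *v v) = \<rho> (torus_elt n (\<lambda>i. s i * t i)) *v v"
proof -
  have "torus_elt n (\<lambda>i. s i * t i) = opD n s (torus_elt n t)"
    by (auto simp: torus_elt_def opD_def fun_eq_iff)
  then show ?thesis
    using rho_op[OF symp_op_opD[OF assms(1)] op_mid_in_Sp[OF symp_op_opD[OF assms(2)]]]
    by (simp add: torus_elt_eq_opD)
qed

section \<open>Decomposition into weight spaces\<close>

text \<open>Matrix coefficients are Laurent polynomials on the torus. The coefficients of one
  character form a matrix \<open>P \<eta>\<close>, which will turn out to be a weight
  projection.\<close>

lemma torus_expansion: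
  "\<exists>F P. finite F \<and> (\<forall>\<eta>\<in>F. \<forall>j\<ge>n. \<eta> j = 0) \<and>
     (\<forall>t v. (\<forall>i<n. t i \<noteq> 0) \<longrightarrow>
        \<rho> (torus_elt n t) *v v = (\<Sum>\<eta>\<in>F. character n \<eta> t *s ((P \<eta> :: 'a^'d^'d) *v v)))"
proof -
  have "laurent n (\<lambda>t. \<rho> (torus_elt n t) $ a $ b)" for a b
  proof -
    obtain f where f: "f \<in> poly_fun n" "\<forall>g\<in>Sp n. \<rho> g $ a $ b = f g"
      using rational unfolding rational_rep_def by blast
    have "\<rho> (torus_elt n t) $ a $ b = f (torus_elt n t)" if "\<forall>i<n. t i \<noteq> 0" for t
      using f op_mid_in_Sp[OF symp_op_opD[OF that]] by (auto simp: torus_elt_eq_opD)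
    then show ?thesis using poly_fun_torus[OF f(1)] unfolding laurent_def by simp
  qed
  define Q where "Q a b F c \<longleftrightarrow> finite F \<and> (\<forall>\<eta>\<in>F. \<forall>j\<ge>n. \<eta> j = 0) \<and>
     (\<forall>t. (\<forall>i<n. t i \<noteq> 0) \<longrightarrow> \<rho> (torus_elt n t) $ a $ b = (\<Sum>\<eta>\<in>F. c \<eta> * character n \<eta> t))" for a b F c
  have "\<exists>F c. Q a b F c" for a b
    using \<open>laurent n (\<lambda>t. \<rho> (torus_elt n t) $ a $ b)\<close> unfolding laurent_def Q_def .
  then obtain F c where "\<And>a b. Q a b (F a b) (c a b)" by metis
  then have F: "\<And>a b. finite (F a b)" "\<And>a b. \<forall>\<eta>\<in>F a b. \<forall>j\<ge>n. \<eta> j = 0"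
    "\<And>a b t. \<forall>i<n. t i \<noteq> 0 \<Longrightarrow> \<rho> (torus_elt n t) $ a $ b = (\<Sum>\<eta>\<in>F a b. c a b \<eta> * character n \<eta> t)"
    by (simp_all add: Q_def)
  define FF where "FF = (\<Union>a b. F a b)"
  define P :: "(nat \<Rightarrow> int) \<Rightarrow> 'a^'d^'d" where "P \<eta> = (\<chi> a b. if \<eta> \<in> F a b then c a b \<eta> else 0)" for \<eta>
  have FF: "finite FF" "\<forall>\<eta>\<in>FF. \<forall>j\<ge>n. \<eta> j = 0" using F(1,2) by (auto simp: FF_def)
  have "\<rho> (torus_elt n t) *v v = (\<Sum>\<eta>\<in>FF. character n \<eta> t *s (P \<eta> *v v))" if t: "\<forall>i<n. t i \<noteq> 0" for t v
  proof -
    have e: "\<rho> (torus_elt n t) $ a $ b = (\<Sum>\<eta>\<in>FF. character n \<eta> t * P \<eta> $ a $ b)" for a b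
      unfolding F(3)[OF t] P_def
      by (rule sum.mono_neutral_cong_left[OF FF(1)]) (auto simp: FF_def)
    show ?thesis
    proof (rule iffD2[OF vec_eq_iff], intro allI)
      fix a
      have "(\<rho> (torus_elt n t) *v v) $ a = (\<Sum>b\<in>UNIV. (\<Sum>\<eta>\<in>FF. character n \<eta> t * P \<eta> $ a $ b) * v $ b)"
        by (simp add: matrix_vector_mult_def e)
      also have "\<dots> = (\<Sum>\<eta>\<in>FF. \<Sum>b\<in>UNIV. character n \<eta> t * (P \<eta> $ a $ b * v $ b))"
        by (subst sum.swap) (simp add: sum_distrib_right mult.assoc)
      finally show "(\<rho> (torus_elt n t) *v v) $ a = (\<Sum>\<eta>\<in>FF. character n \<eta> t *s (P \<eta> *v v)) $ a"
        by (simp add: matrix_vector_mult_def sum_distrib_left)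
    qed
  qed
  then show ?thesis using FF by blast
qed

definition weight_projections :: "(nat \<Rightarrow> int) set \<Rightarrow> ((nat \<Rightarrow> int) \<Rightarrow> 'a^'d^'d) \<Rightarrow> bool" where
  "weight_projections F P \<longleftrightarrow> finite F \<and> (\<forall>\<eta>\<in>F. \<forall>j\<ge>n. \<eta> j = 0) \<and>
     (\<forall>\<eta> v. P \<eta> *v v \<in> V \<eta>) \<and> (\<forall>v. v = (\<Sum>\<eta>\<in>F. P \<eta> *v v)) \<and>
     (\<forall>\<mu> \<nu> v. v \<in> V \<nu> \<longrightarrow> (\<forall>j\<ge>n. \<nu> j = 0) \<longrightarrow> P \<mu> *v v = (if \<mu> = \<nu> then v else 0))"

lemma ex_weight_projections: "\<exists>F P. weight_projections F P"
proof -
  obtain F and P :: "(nat \<Rightarrow> int) \<Rightarrow> 'a^'d^'d" where F: "finite F" "\<forall>\<eta>\<in>F. \<forall>j\<ge>n. \<eta> j = 0"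
    and P: "\<And>t v. \<forall>i<n. t i \<noteq> 0 \<Longrightarrow>
        \<rho> (torus_elt n t) *v v = (\<Sum>\<eta>\<in>F. character n \<eta> t *s (P \<eta> *v v))"
    using torus_expansion by blast
  \<comment> \<open>Zero outside \<open>F\<close>, so that the projection law holds for every
    label.\<close>
  define P' where "P' \<eta> = (if \<eta> \<in> F then P \<eta> else 0)" for \<eta>
  have P': "\<rho> (torus_elt n t) *v v = (\<Sum>\<eta>\<in>F. character n \<eta> t *s (P' \<eta> *v v))" if "\<forall>i<n. t i \<noteq> 0" for t v
    unfolding P[OF that] by (rule sum.cong) (auto simp: P'_def)
  have "weight_projections F P'"
    unfolding weight_projections_def
  proof (intro conjI allI impI F)
    fix \<eta> v
    \<comment> \<open>Compares the characters of \<open>t\<close> in \<rho>(s) \<rho>(t) =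
      \<rho>(st).\<close>
    have "\<rho> (torus_elt n s) *v (P' \<eta> *v v) = character n \<eta> s *s (P' \<eta> *v v)"
      if \<eta>: "\<eta> \<in> F" and s: "\<forall>i<n. s i \<noteq> 0" for s
    proof (rule characters_vec_eqD[OF infinite_field F _ \<eta>])
      fix t :: "nat \<Rightarrow> 'a" assume t: "\<forall>i<n. t i \<noteq> 0"
      have "\<forall>i<n. s i * t i \<noteq> 0" using s t by auto
      have "(\<Sum>\<eta>\<in>F. character n \<eta> t *s (\<rho> (torus_elt n s) *v (P' \<eta> *v v)))
         = \<rho> (torus_elt n s) *v (\<rho> (torus_elt n t) *v v)"
        unfolding P'[OF t] by (simp add: matrix_vector_mult_sum matrix_vector_mult_smult)
      also have "\<dots> = (\<Sum>\<eta>\<in>F. character n \<eta> t *s (character n \<eta> s *s (P' \<eta> *v v)))"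
        unfolding rho_torus_mult[OF s t] P'[OF \<open>\<forall>i<n. s i * t i \<noteq> 0\<close>]
        by (simp add: character_mult vector_smult_assoc mult.commute)
      finally show "(\<Sum>\<eta>\<in>F. character n \<eta> t *s (\<rho> (torus_elt n s) *v (P' \<eta> *v v)))
        = (\<Sum>\<eta>\<in>F. character n \<eta> t *s (character n \<eta> s *s (P' \<eta> *v v)))" .
    qed
    then show "P' \<eta> *v v \<in> V \<eta>"
      by (cases "\<eta> \<in> F") (auto simp: weight_space_def P'_def)
  next
    fix v
    have "torus_elt n (\<lambda>_. 1) = (mid n :: 'a mat2)" by (auto simp: torus_elt_def mid_def fun_eq_iff)
    then show "v = (\<Sum>\<eta>\<in>F. P' \<eta> *v v)" using P'[of "\<lambda>_. 1" v] by (simp add: rho_mid character_def)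
  next
    fix \<mu> \<nu> v assume v: "v \<in> V \<nu>" and \<nu>: "\<forall>j\<ge>n. \<nu> j = 0"
    \<comment> \<open>The weight \<nu> is adjoined because it is not yet known to lie in
      \<open>F\<close>.\<close>
    have "P' \<eta> *v v = (if \<eta> = \<nu> then v else 0)" if \<eta>: "\<eta> \<in> insert \<nu> F" for \<eta>
    proof (rule characters_vec_eqD[OF infinite_field _ _ _ \<eta>])
      fix t :: "nat \<Rightarrow> 'a" assume t: "\<forall>i<n. t i \<noteq> 0"
      have "(\<Sum>\<eta>\<in>insert \<nu> F. character n \<eta> t *s (P' \<eta> *v v)) = (\<Sum>\<eta>\<in>F. character n \<eta> t *s (P' \<eta> *v v))"
        by (rule sum.mono_neutral_right) (use F in \<open>auto simp: P'_def\<close>)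
      also have "\<dots> = character n \<nu> t *s v" using P'[OF t, of v] weight_spaceD[OF v t] by simp
      also have "\<dots> = (\<Sum>\<eta>\<in>insert \<nu> F. if \<eta> = \<nu> then character n \<nu> t *s v else 0)"
        using F(1) by (subst sum.delta) auto
      also have "\<dots> = (\<Sum>\<eta>\<in>insert \<nu> F. character n \<eta> t *s (if \<eta> = \<nu> then v else 0))"
        by (rule sum.cong) auto
      finally show "(\<Sum>\<eta>\<in>insert \<nu> F. character n \<eta> t *s (P' \<eta> *v v))
        = (\<Sum>\<eta>\<in>insert \<nu> F. character n \<eta> t *s (if \<eta> = \<nu> then v else 0))" .
    qed (use F \<nu> in auto)
    then show "P' \<mu> *v v = (if \<mu> = \<nu> then v else 0)"
      by (cases "\<mu> \<in> insert \<nu> F") (auto simp: P'_def)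
  qed
  then show ?thesis by blast
qed

section \<open>Divided powers of root vectors\<close>

text \<open>\<open>E k\<close> is the k-th divided power of the root vector \<open>E 1\<close>; the
  recursion avoids dividing by \<open>k!\<close>, which may vanish in the field. Every large
  truncation is allowed, so that two expansions can share one length.\<close>

definition expansion :: "(nat \<Rightarrow> int) \<Rightarrow> ('a \<Rightarrow> 'a mat2 \<Rightarrow> 'a mat2) \<Rightarrow> (nat \<Rightarrow> 'a^'d^'d) \<Rightarrow> bool" where
  "expansion \<alpha> X E \<longleftrightarrow>
     (\<exists>D. \<forall>D'\<ge>D. \<forall>t v. \<rho> (X t (mid n)) *v v = (\<Sum>k<D'. t ^ k *s (E k *v v))) \<and>
     E 0 = mat 1 \<and>
     (\<forall>k v. E 1 *v (E k *v v) = of_nat (Suc k) *s (E (Suc k) *v v)) \<and>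
     (\<forall>k \<mu> v. v \<in> V \<mu> \<longrightarrow> E k *v v \<in> V (\<lambda>j. \<mu> j + int k * \<alpha> j))"

text \<open>\<open>E k\<close> is the coefficient of \<open>t ^ k\<close>. Additivity of
  \<open>X\<close> gives the recursion, and conjugation by the torus the shift of weights.\<close>

lemma ex_expansion:
  assumes X: "\<And>t. symp_op n (X t)" and X0: "\<And>g. X 0 g = g"
    and Xadd: "\<And>s t g. X s (X t g) = X (s + t) g"
    and Xpoly: "\<And>r c. \<exists>q. \<forall>t. X t (mid n) r c = poly q t"
    and XD: "\<And>h t g. \<forall>i<n. h i \<noteq> 0 \<Longrightarrow> opD n h (X t g) = X (character n \<alpha> h * t) (opD n h g)"
  shows "\<exists>E. expansion \<alpha> X E"
proof -
  have "\<exists>q. \<forall>t. \<rho> (X t (mid n)) $ a $ b = poly q t" for a b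
  proof -
    obtain f where f: "f \<in> poly_fun n" "\<forall>g\<in>Sp n. \<rho> g $ a $ b = f g"
      using rational unfolding rational_rep_def by blast
    then show ?thesis using poly_fun_curve[OF f(1), of "\<lambda>t. X t (mid n)"] Xpoly op_mid_in_Sp[OF X] by auto
  qed
  then obtain q where q: "\<And>a b t. \<rho> (X t (mid n)) $ a $ b = poly (q a b) t" by metis
  define E :: "nat \<Rightarrow> 'a^'d^'d" where "E k = (\<chi> a b. coeff (q a b) k)" for k
  define D where "D = Suc (Max (range (\<lambda>(a,b). degree (q a b))))"
  have D: "degree (q a b) < D" for a b
    unfolding D_def less_Suc_eq_le by (rule Max_ge) auto
  have exp: "\<rho> (X t (mid n)) *v v = (\<Sum>k<D'. t ^ k *s (E k *v v))" if "D' \<ge> D" for D' t v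
  proof (rule iffD2[OF vec_eq_iff], intro allI)
    fix a
    have e: "poly (q a b) t = (\<Sum>k<D'. t ^ k * E k $ a $ b)" for b
    proof -
      have "poly (q a b) t = (\<Sum>k\<le>degree (q a b). coeff (q a b) k * t ^ k)" by (rule poly_altdef)
      also have "\<dots> = (\<Sum>k<D'. coeff (q a b) k * t ^ k)"
        by (rule sum.mono_neutral_left) (use D[of a b] that in \<open>auto simp: coeff_eq_0\<close>)
      finally show ?thesis by (simp add: E_def mult.commute)
    qed
    have "(\<rho> (X t (mid n)) *v v) $ a = (\<Sum>b\<in>UNIV. (\<Sum>k<D'. t ^ k * E k $ a $ b) * v $ b)"
      by (simp add: matrix_vector_mult_def q e)
    also have "\<dots> = (\<Sum>k<D'. \<Sum>b\<in>UNIV. t ^ k * (E k $ a $ b * v $ b))"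
      by (subst sum.swap) (simp add: sum_distrib_right mult.assoc)
    finally show "(\<rho> (X t (mid n)) *v v) $ a = (\<Sum>k<D'. t ^ k *s (E k *v v)) $ a"
      by (simp add: matrix_vector_mult_def sum_distrib_left)
  qed
  have E0: "E 0 *v v = v" for v
  proof -
    have "v = (\<Sum>k<Suc D. 0 ^ k *s (E k *v v))" using exp[of "Suc D" 0 v] by (simp add: X0 rho_mid)
    then show ?thesis by (simp add: sum.lessThan_Suc_shift del: sum.lessThan_Suc)
  qed
  have E1: "E 1 *v (E k *v v) = of_nat (Suc k) *s (E (Suc k) *v v)" for k v
  proof -
    let ?D = "Suc (Suc (D + k))"
    \<comment> \<open>The coefficient of \<open>s\<close> in \<rho>(X s) \<rho>(X t) = \<rho>(X (s +
      t)), by the binomial theorem.\<close>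
    have 1: "E 1 *v (\<rho> (X t (mid n)) *v v) = (\<Sum>k<?D. t ^ k *s (of_nat (Suc k) *s (E (Suc k) *v v)))" for t
    proof -
      have "(\<Sum>j<Suc ?D. s ^ j *s (E j *v (\<rho> (X t (mid n)) *v v)))
          = (\<Sum>j<Suc ?D. s ^ j *s (\<Sum>k<Suc ?D. (of_nat (k choose j) * t ^ (k - j)) *s (E k *v v)))" for s
      proof -
        have "(\<Sum>j<Suc ?D. s ^ j *s (E j *v (\<rho> (X t (mid n)) *v v))) = \<rho> (X (s + t) (mid n)) *v v"
          using exp[of "Suc ?D" s "\<rho> (X t (mid n)) *v v"] rho_op[OF X op_mid_in_Sp[OF X], of s t v]
          by (simp add: Xadd)
        also have "\<dots> = (\<Sum>k<Suc ?D. (s + t) ^ k *s (E k *v v))" by (rule exp) simp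
        also have "\<dots> = (\<Sum>k<Suc ?D. \<Sum>j<Suc ?D. s ^ j *s ((of_nat (k choose j) * t ^ (k - j)) *s (E k *v v)))"
        proof (rule sum.cong)
          fix k assume "k \<in> {..<Suc ?D}"
          have "(s + t) ^ k = (\<Sum>j\<le>k. of_nat (k choose j) * s ^ j * t ^ (k - j))" by (rule binomial_ring)
          also have "\<dots> = (\<Sum>j<Suc ?D. of_nat (k choose j) * s ^ j * t ^ (k - j))"
            by (rule sum.mono_neutral_left) (use \<open>k \<in> _\<close> in \<open>auto simp: binomial_eq_0\<close>)
          finally show "(s + t) ^ k *s (E k *v v)
             = (\<Sum>j<Suc ?D. s ^ j *s ((of_nat (k choose j) * t ^ (k - j)) *s (E k *v v)))"
            by (simp add: vec.scale_sum_left vector_smult_assoc mult_ac del: sum.lessThan_Suc)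
        qed simp
        also have "\<dots> = (\<Sum>j<Suc ?D. s ^ j *s (\<Sum>k<Suc ?D. (of_nat (k choose j) * t ^ (k - j)) *s (E k *v v)))"
          by (subst sum.swap) (simp add: vec_sum_smult del: sum.lessThan_Suc)
        finally show ?thesis .
      qed
      from vec_poly_eqD[OF infinite_field this, of 1]
      have "E 1 *v (\<rho> (X t (mid n)) *v v) = (\<Sum>k<Suc ?D. (of_nat (k choose 1) * t ^ (k - 1)) *s (E k *v v))"
        by simp
      also have "\<dots> = (\<Sum>k<?D. (of_nat (Suc k) * t ^ k) *s (E (Suc k) *v v))"
        by (subst sum.lessThan_Suc_shift) simp
      finally show ?thesis by (simp add: vector_smult_assoc mult.commute del: sum.lessThan_Suc of_nat_Suc)
    qed
    have "(\<Sum>k<?D. t ^ k *s (E 1 *v (E k *v v))) = (\<Sum>k<?D. t ^ k *s (of_nat (Suc k) *s (E (Suc k) *v v)))" for t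
    proof -
      have "\<rho> (X t (mid n)) *v v = (\<Sum>k<?D. t ^ k *s (E k *v v))" by (rule exp) simp
      then show ?thesis
        using 1[of t] by (simp add: matrix_vector_mult_sum matrix_vector_mult_smult
            del: sum.lessThan_Suc of_nat_Suc)
    qed
    from vec_poly_eqD[OF infinite_field this, of k] show ?thesis by simp
  qed
  have EV: "E k *v v \<in> V (\<lambda>j. \<mu> j + int k * \<alpha> j)" if v: "v \<in> V \<mu>" for k \<mu> v
    unfolding weight_space_def
  proof (intro CollectI allI impI)
    fix h :: "nat \<Rightarrow> 'a" assume h: "\<forall>i<n. h i \<noteq> 0"
    let ?D = "Suc (D + k)" and ?c = "character n \<alpha> h"
    have "(\<Sum>k<?D. t ^ k *s (\<rho> (torus_elt n h) *v (E k *v v)))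
        = (\<Sum>k<?D. t ^ k *s ((character n \<mu> h * ?c ^ k) *s (E k *v v)))" for t
    proof -
      have "(\<Sum>k<?D. t ^ k *s (\<rho> (torus_elt n h) *v (E k *v v)))
         = \<rho> (torus_elt n h) *v (\<rho> (X t (mid n)) *v v)"
        using exp[of ?D t v] by (simp add: matrix_vector_mult_sum matrix_vector_mult_smult del: sum.lessThan_Suc)
      also have "\<dots> = \<rho> (X (?c * t) (torus_elt n h)) *v v"
        using rho_op[OF symp_op_opD[OF h] op_mid_in_Sp[OF X], of t v] by (simp add: XD[OF h] torus_elt_eq_opD)
      also have "\<dots> = \<rho> (X (?c * t) (mid n)) *v (character n \<mu> h *s v)"
        using rho_op[OF X op_mid_in_Sp[OF symp_op_opD[OF h]], of "?c * t" v] weight_spaceD[OF v h]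
        by (simp add: torus_elt_eq_opD)
      also have "\<dots> = (\<Sum>k<?D. (?c * t) ^ k *s (E k *v (character n \<mu> h *s v)))" by (rule exp) simp
      also have "\<dots> = (\<Sum>k<?D. t ^ k *s ((character n \<mu> h * ?c ^ k) *s (E k *v v)))"
        by (simp add: matrix_vector_mult_smult vector_smult_assoc power_mult_distrib mult_ac del: sum.lessThan_Suc)
      finally show ?thesis .
    qed
    from vec_poly_eqD[OF infinite_field this, of k]
    show "\<rho> (torus_elt n h) *v (E k *v v) = character n (\<lambda>j. \<mu> j + int k * \<alpha> j) h *s (E k *v v)"
      by (simp add: character_add[OF h] character_scale[OF h])
  qed
  have "E 0 = mat 1" using E0 by (simp add: matrix_eq)
  then have "expansion \<alpha> X E" unfolding expansion_def using exp E1 EV by blast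
  then show ?thesis by blast
qed

definition raise :: "nat \<Rightarrow> nat \<Rightarrow> 'a^'d^'d" where
  "raise k = (SOME E. expansion (sroot n k) (xp n k) E)"

definition lower :: "nat \<Rightarrow> nat \<Rightarrow> 'a^'d^'d" where
  "lower k = (SOME E. expansion (\<lambda>j. - sroot n k j) (xm n k) E)"

lemma expansion_raise: "k < n \<Longrightarrow> expansion (sroot n k) (xp n k) (raise k)"
  unfolding raise_def
  by (rule someI_ex[where P = "expansion (sroot n k) (xp n k)"], rule ex_expansion)
    (simp_all add: symp_op_xp xp_0 xp_add xp_poly opD_xp)

lemma expansion_lower: "k < n \<Longrightarrow> expansion (\<lambda>j. - sroot n k j) (xm n k) (lower k)"
  unfolding lower_def
  by (rule someI_ex[where P = "expansion (\<lambda>j. - sroot n k j) (xm n k)"], rule ex_expansion)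
    (simp_all add: symp_op_xm xm_0 xm_add xm_poly opD_xm)

lemma raise_weight: "k < n \<Longrightarrow> v \<in> V \<mu> \<Longrightarrow> raise k i *v v \<in> V (\<lambda>j. \<mu> j + int i * sroot n k j)"
  using expansion_raise[of k] by (simp add: expansion_def)

lemma lower_weight: "k < n \<Longrightarrow> v \<in> V \<mu> \<Longrightarrow> lower k i *v v \<in> V (\<lambda>j. \<mu> j - int i * sroot n k j)"
  using expansion_lower[of k] by (simp add: expansion_def)

section \<open>Commutation relations of the simple root vectors\<close>

lemma common_expansion:
  assumes "k < n" "l < n"
  obtains D where "D \<ge> 2"
    "\<And>t v. \<rho> (xp n k t (mid n)) *v v = (\<Sum>i<D. t ^ i *s (raise k i *v v))"
    "\<And>t v. \<rho> (xm n l t (mid n)) *v v = (\<Sum>i<D. t ^ i *s (lower l i *v v))"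
proof -
  obtain D1 where 1: "\<And>D' t v. D' \<ge> D1 \<Longrightarrow> \<rho> (xp n k t (mid n)) *v v = (\<Sum>i<D'. t ^ i *s (raise k i *v v))"
    using expansion_raise[OF assms(1)] by (auto simp: expansion_def)
  obtain D2 where 2: "\<And>D' t v. D' \<ge> D2 \<Longrightarrow> \<rho> (xm n l t (mid n)) *v v = (\<Sum>i<D'. t ^ i *s (lower l i *v v))"
    using expansion_lower[OF assms(2)] by (auto simp: expansion_def)
  show ?thesis by (rule that[of "Suc (Suc (D1 + D2))"]) (rule 1 2 | simp)+
qed

text \<open>The coefficient of \<open>s * t\<close> in the commutation of the two root
  subgroups.\<close>

lemma raise_lower_commute:
  assumes k: "k < n" and l: "l < n" and "k \<noteq> l"
  shows "raise k 1 *v (lower l 1 *v v) = lower l 1 *v (raise k 1 *v v)"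
proof -
  obtain D where D: "D \<ge> 2"
    "\<And>t v. \<rho> (xp n k t (mid n)) *v v = (\<Sum>i<D. t ^ i *s (raise k i *v v))"
    "\<And>t v. \<rho> (xm n l t (mid n)) *v v = (\<Sum>i<D. t ^ i *s (lower l i *v v))"
    using common_expansion[OF k l] by blast
  note sx = symp_op_xp[OF k] and sy = symp_op_xm[OF l]
  have 1: "raise k 1 *v (\<rho> (xm n l t (mid n)) *v v) = \<rho> (xm n l t (mid n)) *v (raise k 1 *v v)" for t
  proof -
    have "(\<Sum>i<D. s ^ i *s (raise k i *v (\<rho> (xm n l t (mid n)) *v v)))
      = (\<Sum>i<D. s ^ i *s (\<rho> (xm n l t (mid n)) *v (raise k i *v v)))" for s
    proof -
      have "\<rho> (xp n k s (xm n l t (mid n))) *v v = \<rho> (xm n l t (xp n k s (mid n))) *v v"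
        by (simp add: xp_xm_commute[OF assms])
      then have "\<rho> (xp n k s (mid n)) *v (\<rho> (xm n l t (mid n)) *v v)
          = \<rho> (xm n l t (mid n)) *v (\<rho> (xp n k s (mid n)) *v v)"
        by (simp add: rho_op[OF sx op_mid_in_Sp[OF sy]] rho_op[OF sy op_mid_in_Sp[OF sx]])
      then show ?thesis unfolding D(2) by (simp add: matrix_vector_mult_sum matrix_vector_mult_smult)
    qed
    from vec_poly_eqD[OF infinite_field this, of 1] D(1) show ?thesis by simp
  qed
  have "(\<Sum>i<D. t ^ i *s (raise k 1 *v (lower l i *v v))) = (\<Sum>i<D. t ^ i *s (lower l i *v (raise k 1 *v v)))" for t
    using 1[of t] unfolding D(3) by (simp add: matrix_vector_mult_sum matrix_vector_mult_smult)
  from vec_poly_eqD[OF infinite_field this, of 1] D(1) show ?thesis by simp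
qed

text \<open>\<open>xp_xm_swap\<close> is applied to \<open>v\<close> and projected back to the
  weight \<mu>. This leaves a polynomial identity in \<open>z\<close>, up to a power of
  \<open>1 + z\<close>, whose linear coefficient is the claim.\<close>

lemma raise_lower_pairing:
  assumes k: "k < n" and v: "v \<in> V \<mu>" and \<mu>: "\<forall>j\<ge>n. \<mu> j = 0"
  shows "raise k 1 *v (lower k 1 *v v) = lower k 1 *v (raise k 1 *v v) + of_int (pairing n k \<mu>) *s v"
proof -
  obtain D where D: "D \<ge> 2"
    "\<And>t v. \<rho> (xp n k t (mid n)) *v v = (\<Sum>i<D. t ^ i *s (raise k i *v v))"
    "\<And>t v. \<rho> (xm n k t (mid n)) *v v = (\<Sum>i<D. t ^ i *s (lower k i *v v))"
    using common_expansion[OF k k] by blast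
  obtain F and P :: "(nat \<Rightarrow> int) \<Rightarrow> 'a^'d^'d" where
    P: "\<And>\<mu> \<nu> v. v \<in> V \<nu> \<Longrightarrow> \<forall>j\<ge>n. \<nu> j = 0 \<Longrightarrow> P \<mu> *v v = (if \<mu> = \<nu> then v else 0)"
    using ex_weight_projections unfolding weight_projections_def by metis
  let ?d = "pairing n k \<mu>"
  define x where "x a = raise k a *v (lower k a *v v)" for a
  define y where "y a = lower k a *v (raise k a *v v)" for a
  have sr: "sroot n k j = 0" if "j \<ge> n" for j using that k by (auto simp: sroot_def)
  \<comment> \<open>Only equally many raising and lowering steps return to the weight \<mu>.\<close>
  have P1: "P \<mu> *v (raise k a *v (lower k b *v v)) = (if a = b then x a else 0)"
    and P2: "P \<mu> *v (lower k b *v (raise k a *v v)) = (if a = b then y a else 0)" for a b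
  proof -
    have neq: "a = b" if "\<mu> = (\<lambda>j. \<mu> j - int b * sroot n k j + int a * sroot n k j)"
      using fun_cong[OF that, of k] by (auto simp: sroot_def split: if_splits)
    have neq': "a = b" if "\<mu> = (\<lambda>j. \<mu> j + int a * sroot n k j - int b * sroot n k j)"
      using fun_cong[OF that, of k] by (auto simp: sroot_def split: if_splits)
    show "P \<mu> *v (raise k a *v (lower k b *v v)) = (if a = b then x a else 0)"
      using neq by (subst P[OF raise_weight[OF k lower_weight[OF k v]]]) (use \<mu> sr in \<open>auto simp: x_def\<close>)
    show "P \<mu> *v (lower k b *v (raise k a *v v)) = (if a = b then y a else 0)"
      using neq' by (subst P[OF lower_weight[OF k raise_weight[OF k v]]]) (use \<mu> sr in \<open>auto simp: y_def\<close>)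
  qed
  have key: "(\<Sum>a<D. z ^ a *s x a) = (1 + z) powi ?d *s (\<Sum>a<D. z ^ a *s y a)" if z: "1 + z \<noteq> 0" for z
  proof -
    let ?u = "1 + z"
    have nz: "\<forall>i<n. coroot n k ?u i \<noteq> 0" using z by (auto simp: coroot_def)
    note sx = symp_op_xp[OF k] and sy = symp_op_xm[OF k] and sd = symp_op_opD[OF nz]
    let ?R = "\<Sum>b<D. (1 / ?u) ^ b *s (lower k b *v (\<Sum>a<D. ((z / ?u) ^ a * ?u powi (?d + 2 * int a)) *s (raise k a *v v)))"
    have tor: "\<rho> (torus_elt n (coroot n k ?u)) *v (raise k a *v v) = ?u powi (?d + 2 * int a) *s (raise k a *v v)" for a
    proof -
      have "pairing n k (\<lambda>j. \<mu> j + int a * sroot n k j) = ?d + 2 * int a"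
        by (auto simp: pairing_def sroot_def)
      then show ?thesis
        using weight_spaceD[OF raise_weight[OF k v] nz] by (simp add: character_coroot[OF k z])
    qed
    have "(\<Sum>a<D. z ^ a *s (raise k a *v (\<Sum>b<D. lower k b *v v)))
        = \<rho> (xp n k z (xm n k 1 (mid n))) *v v"
      unfolding rho_op[OF sx op_mid_in_Sp[OF sy]] D(2) D(3) by simp
    also have "\<dots> = \<rho> (xm n k (1 / ?u) (opD n (coroot n k ?u) (xp n k (z / ?u) (mid n)))) *v v"
      by (simp add: xp_xm_swap[OF k z supp_mid])
    also have "\<dots> = \<rho> (xm n k (1 / ?u) (mid n)) *v (\<rho> (torus_elt n (coroot n k ?u)) *v (\<rho> (xp n k (z / ?u) (mid n)) *v v))"
      using sd op_mid_in_Sp[OF sx, of "z / ?u"]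
      by (subst rho_op[OF sy]) (auto simp: symp_op_def rho_op[OF sd] torus_elt_eq_opD)
    also have "\<dots> = ?R"
      unfolding D(2) D(3) by (simp add: matrix_vector_mult_sum matrix_vector_mult_smult tor vector_smult_assoc)
    finally have "P \<mu> *v (\<Sum>a<D. z ^ a *s (raise k a *v (\<Sum>b<D. lower k b *v v))) = P \<mu> *v ?R" by simp
    moreover have "P \<mu> *v (\<Sum>a<D. z ^ a *s (raise k a *v (\<Sum>b<D. lower k b *v v))) = (\<Sum>a<D. z ^ a *s x a)"
      by (simp add: matrix_vector_mult_sum matrix_vector_mult_smult P1)
    moreover have "P \<mu> *v ?R = (\<Sum>b<D. (1 / ?u) ^ b *s (((z / ?u) ^ b * ?u powi (?d + 2 * int b)) *s y b))"
      by (simp add: matrix_vector_mult_sum matrix_vector_mult_smult P2 if_distrib[of "\<lambda>v. _ *s v"] cong: if_cong)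
    moreover have "\<dots> = ?u powi ?d *s (\<Sum>a<D. z ^ a *s y a)"
    proof -
      have "(1 / ?u) ^ b * ((z / ?u) ^ b * ?u powi (?d + 2 * int b)) = ?u powi ?d * z ^ b" for b
        using z by (simp add: power_int_add power_int_mult power_divide power_mult field_simps power2_eq_square power_mult_distrib)
      then show ?thesis by (simp add: vec_sum_smult vector_smult_assoc)
    qed
    ultimately show ?thesis by simp
  qed
  \<comment> \<open>The pairing may be negative. Multiplication by \<open>(1 + z) ^ M\<close> makes
    both sides polynomial, and \<open>N - M\<close> is the pairing.\<close>
  define M where "M = nat (- ?d)"
  define N where "N = nat (int M + ?d)"
  have MN: "int N = int M + ?d" by (simp add: M_def N_def)
  have "x 1 $ c + of_nat M * v $ c = y 1 $ c + of_nat N * v $ c" for c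
  proof -
    have "[:1,1:] ^ M * vpoly D x c = [:1,1:] ^ N * vpoly D y c"
    proof (rule poly_eqI_cofinite[OF infinite_field, of "{-1}"])
      fix z :: 'a assume "z \<notin> {-1}"
      then have z: "1 + z \<noteq> 0" by (metis add_eq_0_iff insertI1)
      have "(1 + z) ^ N = (1 + z) ^ M * (1 + z) powi ?d"
        using z MN by (metis power_int_add power_int_of_nat)
      then show "poly ([:1, 1:] ^ M * vpoly D x c) z = poly ([:1, 1:] ^ N * vpoly D y c) z"
        using arg_cong[OF key[OF z], of "\<lambda>v. v $ c"] by (simp add: poly_vpoly poly_power)
    qed simp
    then have "coeff ([:1,1:] ^ M * vpoly D x c) 1 = coeff ([:1,1:] ^ N * vpoly D y c) 1" by simp
    moreover have "x 0 = v" "y 0 = v"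
      using expansion_raise[OF k] expansion_lower[OF k] by (simp_all add: x_def y_def expansion_def)
    ultimately show ?thesis using D(1)
      by (simp add: coeff_mult_1 coeff_linear_power coeff_vpoly del: One_nat_def)
  qed
  moreover have "(of_nat N :: 'a) = of_nat M + of_int ?d"
    by (metis MN of_int_add of_int_of_nat_eq)
  ultimately have "x 1 = y 1 + of_int ?d *s v"
    by (simp add: vec_eq_iff algebra_simps)
  then show ?thesis by (simp add: x_def y_def)
qed

end

section \<open>The oscillator action\<close>

definition int_sign :: "int \<Rightarrow> int" where "int_sign k = (if even k then 1 else -1)"

lemma int_sign_add: "int_sign (a + b) = int_sign a * int_sign b"
  by (auto simp: int_sign_def)

lemma int_sign_sum: "int_sign (\<Sum>x\<in>A. f x) = (\<Prod>x\<in>A. int_sign (f x))"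
  by (induction A rule: infinite_finite_induct) (auto simp: int_sign_add, auto simp: int_sign_def)

definition cube :: "nat \<Rightarrow> int \<Rightarrow> (nat \<Rightarrow> int) set" where
  "cube n m = {\<mu>. (\<forall>j\<ge>n. \<mu> j = 0) \<and> (\<forall>j<n. \<bar>\<mu> j\<bar> \<le> m)}"

lemma bij_betw_cube:
  "bij_betw (\<lambda>g j. if j < n then g j else 0) (PiE {..<n} (\<lambda>_. {-m..m})) (cube n m)"
proof (rule bij_betwI[where g = "\<lambda>\<mu>. restrict \<mu> {..<n}"])
  show "(\<lambda>g j. if j < n then g j else 0) \<in> (PiE {..<n} (\<lambda>_. {-m..m})) \<rightarrow> cube n m"
    by (force simp: cube_def PiE_def Pi_def)
  show "(\<lambda>\<mu>. restrict \<mu> {..<n}) \<in> cube n m \<rightarrow> (PiE {..<n} (\<lambda>_. {-m..m}))"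
    by (force simp: cube_def)
  show "restrict (\<lambda>j. if j < n then g j else 0) {..<n} = g" if "g \<in> PiE {..<n} (\<lambda>_. {-m..m})" for g
    using that by (auto simp: fun_eq_iff restrict_def PiE_def extensional_def)
  show "(\<lambda>j. if j < n then restrict \<mu> {..<n} j else 0) = \<mu>" if "\<mu> \<in> cube n m" for \<mu>
    using that by (auto simp: fun_eq_iff cube_def)
qed

lemma finite_cube: "finite (cube n m)"
  using bij_betw_finite[OF bij_betw_cube[of n m]] by (simp add: finite_PiE)

lemma card_cube: assumes "m \<ge> 0" shows "int (card (cube n m)) = (2 * m + 1) ^ n"
proof -
  have "card (cube n m) = nat (2 * m + 1) ^ n"
    using bij_betw_same_card[OF bij_betw_cube[of n m]] assms by (simp add: card_PiE add.commute)
  then show ?thesis using assms by simp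
qed

lemma sum_int_sign: "(\<Sum>k\<in>{- int M..int M}. int_sign (int M - k)) = 1"
proof -
  have "(\<Sum>k\<in>{- int M..int M}. int_sign (int M - k)) = (\<Sum>i\<in>{..2 * M}. int_sign (int i))"
    by (rule sum.reindex_bij_witness[of _ "\<lambda>i. int M - int i" "\<lambda>k. nat (int M - k)"]) auto
  also have "\<dots> = 1"
    by (induction M) (auto simp: int_sign_def)
  finally show ?thesis .
qed

text \<open>The signed sum factors over the coordinates; each factor is an alternating sum of odd
  length starting with 1. So one parity class exceeds the other by one.\<close>

lemma sum_sign_cube:
  assumes "m \<ge> 0" shows "(\<Sum>\<mu>\<in>cube n m. int_sign (\<Sum>j<n. m - \<mu> j)) = 1"
proof -
  have "(\<Sum>\<mu>\<in>cube n m. int_sign (\<Sum>j<n. m - \<mu> j))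
      = (\<Sum>g\<in>PiE {..<n} (\<lambda>_. {-m..m}). \<Prod>j<n. int_sign (m - g j))"
    by (subst sum.reindex_bij_betw[OF bij_betw_cube, symmetric]) (simp add: int_sign_sum)
  also have "\<dots> = (\<Prod>j<n. \<Sum>k\<in>{-m..m}. int_sign (m - k))"
    by (rule prod_sum_PiE[symmetric]) auto
  also have "\<dots> = 1" using sum_int_sign[of "nat m"] assms by simp
  finally show ?thesis .
qed

text \<open>One coset of the root lattice inside the cube: in type C the lattice consists of the
  integer vectors with even coordinate sum.\<close>

definition weyl_box :: "nat \<Rightarrow> int \<Rightarrow> int \<Rightarrow> (nat \<Rightarrow> int) set" where
  "weyl_box n m \<delta> = {\<mu> \<in> cube n m. even ((\<Sum>j<n. m - \<mu> j) - \<delta>)}"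

text \<open>Sum and difference of the sizes of the two parity classes are both known.\<close>

lemma card_weyl_box:
  assumes "m \<ge> 0" "\<delta> \<in> {0, 1}"
  shows "2 * int (card (weyl_box n m \<delta>)) = (2 * m + 1) ^ n + (if \<delta> = 0 then 1 else -1)"
proof -
  have un: "cube n m = weyl_box n m 0 \<union> weyl_box n m 1" "weyl_box n m 0 \<inter> weyl_box n m 1 = {}"
    by (auto simp: weyl_box_def)
  have fin: "finite (weyl_box n m 0)" "finite (weyl_box n m 1)"
    using finite_cube[of n m] by (auto simp: weyl_box_def)
  have 1: "int (card (weyl_box n m 0)) + int (card (weyl_box n m 1)) = (2 * m + 1) ^ n"
    using card_cube[OF assms(1), of n] card_Un_disjoint[OF fin un(2)] un(1) by simp
  have "(\<Sum>\<mu>\<in>weyl_box n m 0. int_sign (\<Sum>j<n. m - \<mu> j)) + (\<Sum>\<mu>\<in>weyl_box n m 1. int_sign (\<Sum>j<n. m - \<mu> j)) = 1"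
    using sum_sign_cube[OF assms(1), of n] sum.union_disjoint[OF fin un(2)] un(1) by metis
  moreover have "(\<Sum>\<mu>\<in>weyl_box n m 0. int_sign (\<Sum>j<n. m - \<mu> j)) = int (card (weyl_box n m 0))"
    by (subst sum.cong[OF refl, where h = "\<lambda>_. 1"]) (auto simp: weyl_box_def int_sign_def)
  moreover have "(\<Sum>\<mu>\<in>weyl_box n m 1. int_sign (\<Sum>j<n. m - \<mu> j)) = - int (card (weyl_box n m 1))"
    by (subst sum.cong[OF refl, where h = "\<lambda>_. -1"]) (auto simp: weyl_box_def int_sign_def)
  ultimately show ?thesis using 1 assms(2) by auto
qed

section \<open>Translations by simple roots, and the operators on monomials\<close>

definition up :: "nat \<Rightarrow> nat \<Rightarrow> (nat \<Rightarrow> int) \<Rightarrow> nat \<Rightarrow> int" where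
  "up n k \<mu> = (\<lambda>j. \<mu> j + sroot n k j)"

definition down :: "nat \<Rightarrow> nat \<Rightarrow> (nat \<Rightarrow> int) \<Rightarrow> nat \<Rightarrow> int" where
  "down n k \<mu> = (\<lambda>j. \<mu> j - sroot n k j)"

lemma up_down [simp]: "up n k (down n k \<mu>) = \<mu>" "down n k (up n k \<mu>) = \<mu>"
  by (auto simp: up_def down_def)

lemma down_up_commute: "down n k (up n l \<mu>) = up n l (down n k \<mu>)"
  by (auto simp: up_def down_def)

lemma up_eq_iff: "up n k \<mu> = \<nu> \<longleftrightarrow> \<mu> = down n k \<nu>"
  by auto

text \<open>A linear functional that is positive on the simple roots; it serves as induction measure
  and detects weights above the highest one.\<close>

definition ht :: "nat \<Rightarrow> (nat \<Rightarrow> int) \<Rightarrow> int" where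
  "ht n \<mu> = (\<Sum>j<n. (int n - int j) * \<mu> j)"

lemma ht_sroot: assumes "k < n" shows "ht n (sroot n k) > 0"
proof (cases "k + 1 < n")
  case True
  have "ht n (sroot n k) = (\<Sum>j<n. (if j = k then int n - int k else 0) - (if j = k + 1 then int n - int (k+1) else 0))"
    unfolding ht_def by (rule sum.cong) (use True in \<open>auto simp: sroot_def\<close>)
  then show ?thesis using True by (simp add: sum_subtractf)
next
  case False
  have "ht n (sroot n k) = (\<Sum>j<n. if j = k then (int n - int k) * 2 else 0)"
    unfolding ht_def by (rule sum.cong) (use False in \<open>auto simp: sroot_def\<close>)
  then show ?thesis using assms by simp
qed

lemma ht_up: "ht n (up n k \<mu>) = ht n \<mu> + ht n (sroot n k)"
  and ht_down: "ht n (down n k \<mu>) = ht n \<mu> - ht n (sroot n k)"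
  by (simp_all add: ht_def up_def down_def algebra_simps sum.distrib sum_subtractf)

lemma even_sum_sroot: "even (\<Sum>j<n. sroot n k j)"
proof (cases "k + 1 < n")
  case True
  have "(\<Sum>j<n. sroot n k j) = (\<Sum>j<n. (if j = k then 1 else 0) - (if j = k + 1 then 1 else 0))"
    by (rule sum.cong) (use True in \<open>auto simp: sroot_def\<close>)
  then show ?thesis using True by (simp add: sum_subtractf)
next
  case False
  have "(\<Sum>j<n. sroot n k j) = (\<Sum>j<n. if j = k then 2 else 0)"
    by (rule sum.cong) (use False in \<open>auto simp: sroot_def\<close>)
  then show ?thesis by simp
qed

text \<open>The oscillator action on Laurent monomials \<open>x\<^sup>a\<close>, where \<open>x\<^sup>a\<close> has weight \<open>\<mu> = m - a\<close>:
  with \<open>\<partial>\<^sub>k\<close> the partial derivatives, the simple root vectors act as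
  \<open>x\<^sub>k\<^sub>+\<^sub>1 \<partial>\<^sub>k\<close>, \<open>x\<^sub>k \<partial>\<^sub>k\<^sub>+\<^sub>1\<close> and, for the long root, as \<open>- \<partial>\<^sub>k\<^sup>2/2\<close>, \<open>x\<^sub>k\<^sup>2/2\<close>.
  A vector is represented by its coefficient function, indexed by weights.\<close>

definition osc_up :: "nat \<Rightarrow> int \<Rightarrow> nat \<Rightarrow> ((nat \<Rightarrow> int) \<Rightarrow> 'a::field) \<Rightarrow> (nat \<Rightarrow> int) \<Rightarrow> 'a" where
  "osc_up n m k f \<mu> = (if k + 1 < n then of_int (m - \<mu> k + 1)
     else - of_int ((m - \<mu> k + 2) * (m - \<mu> k + 1)) / 2) * f (down n k \<mu>)"

definition osc_down :: "nat \<Rightarrow> int \<Rightarrow> nat \<Rightarrow> ((nat \<Rightarrow> int) \<Rightarrow> 'a::field) \<Rightarrow> (nat \<Rightarrow> int) \<Rightarrow> 'a" where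
  "osc_down n m k f \<mu> = (if k + 1 < n then of_int (m - \<mu> (k+1) + 1) else 1 / 2) * f (up n k \<mu>)"

lemma osc_linear:
  "osc_up n m k (\<lambda>\<nu>. f \<nu> + c * g \<nu>) = (\<lambda>\<nu>. osc_up n m k f \<nu> + c * osc_up n m k g \<nu>)"
  "osc_down n m k (\<lambda>\<nu>. f \<nu> + c * g \<nu>) = (\<lambda>\<nu>. osc_down n m k f \<nu> + c * osc_down n m k g \<nu>)"
  "osc_up n m k (\<lambda>\<nu>. 0) = (\<lambda>\<nu>. 0)" "osc_down n m k (\<lambda>\<nu>. 0) = (\<lambda>\<nu>. 0)"
  by (simp_all add: osc_up_def osc_down_def fun_eq_iff algebra_simps)

text \<open>If the two operators share a variable, both differentiate by it or both multiply by
  it.\<close>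

lemma osc_commute:
  assumes "k < n" "l < n" "k \<noteq> l"
  shows "osc_up n m k (osc_down n m l f) = osc_down n m l (osc_up n m k f)"
proof
  fix \<mu>
  show "osc_up n m k (osc_down n m l f) \<mu> = osc_down n m l (osc_up n m k f) \<mu>"
    unfolding osc_up_def osc_down_def down_up_commute
    using assms by (auto simp: up_def down_def sroot_def)
qed

text \<open>The long root commutator multiplies \<open>x\<^sup>a\<close> by
  \<open>- a - 1/2\<close>, with \<open>a\<close> the last exponent. Since \<open>2 * m + 1\<close>
  vanishes in the field, this is the weight coordinate \<open>m - a\<close>.\<close>

lemma osc_pairing:
  assumes "k < n" "of_int (2 * m + 1) = (0::'a::field)" "(2::'a) \<noteq> 0"
  shows "osc_up n m k (osc_down n m k f) \<mu>
       = osc_down n m k (osc_up n m k f) \<mu> + of_int (pairing n k \<mu>) * (f \<mu> :: 'a)"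
proof (cases "k + 1 < n")
  case True
  then show ?thesis
    by (simp add: osc_up_def osc_down_def) (simp add: up_def down_def sroot_def pairing_def algebra_simps)
next
  case False
  have m: "of_int m * 2 = (-1::'a)" using assms(2) by (simp add: eq_neg_iff_add_eq_0 mult.commute)
  define a :: 'a where "a = of_int (\<mu> k)"
  define b :: 'a where "b = of_int m"
  have "- ((b - a + 2) * (b - a + 1)) / 2 * (1 / 2 * f \<mu>)
      = 1 / 2 * (- ((b - (a + 2) + 2) * (b - (a + 2) + 1)) / 2 * f \<mu>) + a * f \<mu>"
  proof -
    have "- ((b - a + 2) * (b - a + 1)) = - ((b - (a + 2) + 2) * (b - (a + 2) + 1)) + 4 * a"
    proof -
      have "b * 4 = (b * 2) * 2" by simp
      also have "\<dots> = -2" unfolding b_def m by simp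
      finally have "b * 4 = -2" .
      then show ?thesis by (simp add: algebra_simps)
    qed
    note key = this
    have step: "x / t * (1 / t * z) = 1 / t * (y / t * z) + a * z"
      if "x = y + (t * t) * a" "t \<noteq> 0" for x y z t :: 'a
      using that by (simp add: field_simps)
    show ?thesis by (rule step[OF _ assms(3)]) (use key in simp)
  qed
  then show ?thesis using False
    by (simp add: osc_up_def osc_down_def) (simp add: up_def down_def sroot_def pairing_def a_def b_def)
qed

section \<open>Comparison with the oscillator action\<close>

definition delta :: "'b \<Rightarrow> 'b \<Rightarrow> 'a::zero_neq_one" where
  "delta \<mu> = (\<lambda>\<nu>. if \<nu> = \<mu> then 1 else 0)"

text \<open>What the comparison needs from the representation: root vectors with their relations,
  weight projections, irreducibility under the root vectors, and weights confined to the box.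
  \<open>char\<close> encodes characteristic \<open>2 * m + 1\<close>.\<close>

locale oscillator_module =
  fixes n :: nat and m \<delta> :: int
    and E F :: "nat \<Rightarrow> 'a::field^'d^'d" and V :: "(nat \<Rightarrow> int) \<Rightarrow> ('a^'d) set"
    and P :: "(nat \<Rightarrow> int) \<Rightarrow> 'a^'d^'d" and wts :: "(nat \<Rightarrow> int) set"
    and \<Lambda> :: "nat \<Rightarrow> int" and vp :: "'a^'d"
  assumes n: "n \<ge> 1" and m: "m \<ge> 1" and \<delta>: "\<delta> \<in> {0, 1}"
    and char: "\<And>z::int. of_int z = (0::'a) \<longleftrightarrow> (2 * m + 1) dvd z"
    and V_subspace: "vec.subspace (V \<mu>)"
    and E_weight: "k < n \<Longrightarrow> v \<in> V \<mu> \<Longrightarrow> E k *v v \<in> V (up n k \<mu>)"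
    and F_weight: "k < n \<Longrightarrow> v \<in> V \<mu> \<Longrightarrow> F k *v v \<in> V (down n k \<mu>)"
    and EF_commute: "k < n \<Longrightarrow> l < n \<Longrightarrow> k \<noteq> l \<Longrightarrow> E k *v (F l *v v) = F l *v (E k *v v)"
    and EF_pairing: "k < n \<Longrightarrow> v \<in> V \<mu> \<Longrightarrow> \<forall>j\<ge>n. \<mu> j = 0 \<Longrightarrow>
        E k *v (F k *v v) = F k *v (E k *v v) + of_int (pairing n k \<mu>) *s v"
    and wts: "finite wts" "\<forall>\<eta>\<in>wts. \<forall>j\<ge>n. \<eta> j = 0"
    and P_weight: "P \<eta> *v v \<in> V \<eta>"
    and P_sum: "v = (\<Sum>\<eta>\<in>wts. P \<eta> *v v)"
    and P_proj: "v \<in> V \<nu> \<Longrightarrow> \<forall>j\<ge>n. \<nu> j = 0 \<Longrightarrow> P \<eta> *v v = (if \<eta> = \<nu> then v else 0)"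
    and simple: "vec.subspace W \<Longrightarrow> (\<And>k w. k < n \<Longrightarrow> w \<in> W \<Longrightarrow> E k *v w \<in> W \<and> F k *v w \<in> W)
        \<Longrightarrow> W = {0} \<or> W = UNIV"
    and weights_in_box: "\<forall>j\<ge>n. \<mu> j = 0 \<Longrightarrow> v \<in> V \<mu> \<Longrightarrow> v \<noteq> 0 \<Longrightarrow> \<mu> \<in> weyl_box n m \<delta>"
    and \<Lambda>: "\<Lambda> = (\<lambda>j. if j < n then m - (if j = n - 1 then \<delta> else 0) else 0)"
    and vp: "vp \<in> V \<Lambda>" "vp \<noteq> 0" "\<And>k. k < n \<Longrightarrow> E k *v vp = 0"
begin

lemma char_2m1: "of_int (2 * m + 1) = (0::'a)"
  by (simp only: char dvd_refl)

lemma of_int_nonzero: "0 < k \<Longrightarrow> k \<le> 2 * m \<Longrightarrow> of_int k \<noteq> (0::'a)"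
  by (simp only: char) (auto dest: zdvd_imp_le)

lemma two_nonzero: "(2::'a) \<noteq> 0"
  using of_int_nonzero[of 2] m by simp

abbreviation "eu \<equiv> osc_up n m"
abbreviation "ed \<equiv> osc_down n m"

section \<open>The span of matched pairs\<close>

text \<open>Pairs obtained from the top vector and the top monomial by one and the same lowering
  word, with their common weight.\<close>

inductive hom :: "(nat \<Rightarrow> int) \<Rightarrow> 'a^'d \<Rightarrow> ((nat \<Rightarrow> int) \<Rightarrow> 'a) \<Rightarrow> bool" where
  hom_top: "hom \<Lambda> vp (delta \<Lambda>)"
| hom_down: "k < n \<Longrightarrow> hom \<mu> v f \<Longrightarrow> hom (down n k \<mu>) (F k *v v) (ed k f)"

text \<open>The span of these pairs. It turns out to be the graph of a linear map from a space of
  functions onto the module.\<close>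

inductive R :: "'a^'d \<Rightarrow> ((nat \<Rightarrow> int) \<Rightarrow> 'a) \<Rightarrow> bool" where
  R_0: "R 0 (\<lambda>_. 0)"
| R_step: "R v f \<Longrightarrow> hom \<mu> w g \<Longrightarrow> R (v + c *s w) (\<lambda>\<nu>. f \<nu> + c * g \<nu>)"

lemma hom_supp: "hom \<mu> v f \<Longrightarrow> \<forall>j\<ge>n. \<mu> j = 0"
  by (induction rule: hom.induct) (auto simp: \<Lambda> down_def sroot_def)

lemma hom_V: "hom \<mu> v f \<Longrightarrow> v \<in> V \<mu>"
  by (induction rule: hom.induct) (auto simp: vp F_weight)

lemma hom_fun: "hom \<mu> v f \<Longrightarrow> \<nu> \<noteq> \<mu> \<Longrightarrow> f \<nu> = 0"
  by (induction arbitrary: \<nu> rule: hom.induct) (auto simp: delta_def osc_down_def up_eq_iff)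

text \<open>Every lowering step reduces the height, so the weight \<open>\<Lambda>\<close> belongs
  to the empty word only.\<close>

lemma hom_ht: "hom \<mu> v f \<Longrightarrow> (v = vp \<and> f = delta \<Lambda>) \<or> ht n \<mu> < ht n \<Lambda>"
proof (induction rule: hom.induct)
  case (hom_down k \<mu> v f)
  have "ht n \<mu> \<le> ht n \<Lambda>" using hom_down.IH
  proof
    assume "v = vp \<and> f = delta \<Lambda>"
    then have "f \<Lambda> \<noteq> 0" by (simp add: delta_def)
    then show ?thesis using hom_fun[OF hom_down.hyps(2), of \<Lambda>] by auto
  qed simp
  then show ?case using ht_sroot[OF hom_down.hyps(1)] by (simp add: ht_down)
qed simp

lemma R_hom: "hom \<mu> w g \<Longrightarrow> R w g"
  using R_step[OF R_0, of \<mu> w g 1] by simp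

lemma R_lin: "R w g \<Longrightarrow> R v f \<Longrightarrow> R (v + c *s w) (\<lambda>\<nu>. f \<nu> + c * g \<nu>)"
proof (induction arbitrary: v f c rule: R.induct)
  case (R_step w g \<mu> u h d)
  from R.R_step[OF R_step.IH[OF R_step.prems, of c] R_step.hyps(2), of "c * d"]
  show ?case by (simp add: vector_add_ldistrib vector_smult_assoc algebra_simps)
qed simp

lemma R_diff: "R v f \<Longrightarrow> R w g \<Longrightarrow> R (v - w) (\<lambda>\<nu>. f \<nu> - g \<nu>)"
  using R_lin[of w g v f "-1"] by simp

lemma R_F: "R v f \<Longrightarrow> k < n \<Longrightarrow> R (F k *v v) (ed k f)"
proof (induction rule: R.induct)
  case R_0
  then show ?case using R.R_0 by (simp add: osc_linear)
next
  case (R_step v f \<mu> w g c)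
  then show ?case
    using R.R_step[OF R_step.IH hom_down, of k \<mu> w g c]
    by (simp add: osc_linear matrix_vector_right_distrib matrix_vector_mult_smult)
qed

text \<open>The top monomial is 1 or the last variable; it is killed by the second derivative in
  that variable and by first derivatives in the others.\<close>

lemma eu_delta_top: assumes k: "k < n" shows "eu k (delta \<Lambda>) = (\<lambda>_. 0 :: 'a)"
proof
  fix \<nu>
  show "eu k (delta \<Lambda>) \<nu> = (0::'a)"
  proof (cases "down n k \<nu> = \<Lambda>")
    case True
    then have "\<nu> k = \<Lambda> k + sroot n k k" by (auto simp: down_def)
    then show ?thesis using k \<delta> by (auto simp: osc_up_def sroot_def \<Lambda>)
  qed (simp add: osc_up_def delta_def)
qed

text \<open>Induction on the word: the raising operator is moved past the last lowering one, and
  both sides pick up the same commutator.\<close>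

lemma hom_E: "hom \<mu> v f \<Longrightarrow> k < n \<Longrightarrow> R (E k *v v) (eu k f)"
proof (induction rule: hom.induct)
  case hom_top
  then show ?case using R_0 by (simp add: vp eu_delta_top)
next
  case (hom_down l \<mu> v f)
  note FE = R_F[OF hom_down.IH[OF hom_down.prems] hom_down.hyps(1)]
  show ?case
  proof (cases "k = l")
    case False
    then show ?thesis using FE hom_down by (simp add: EF_commute osc_commute)
  next
    case True
    have "eu k (ed k f) = (\<lambda>\<nu>. ed k (eu k f) \<nu> + of_int (pairing n k \<mu>) * f \<nu>)"
    proof
      fix \<nu>
      \<comment> \<open>The function is supported at \<mu>, so the operator
        \<open>pairing n k \<nu>\<close> acts as the scalar
        \<open>pairing n k \<mu>\<close>.\<close>
      have "of_int (pairing n k \<nu>) * f \<nu> = of_int (pairing n k \<mu>) * f \<nu>"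
        using hom_fun[OF hom_down.hyps(2), of \<nu>] by (cases "\<nu> = \<mu>") auto
      then show "eu k (ed k f) \<nu> = ed k (eu k f) \<nu> + of_int (pairing n k \<mu>) * f \<nu>"
        using osc_pairing[OF hom_down.prems char_2m1 two_nonzero, of f \<nu>] by simp
    qed
    then show ?thesis
      using R.R_step[OF FE hom_down.hyps(2), of "of_int (pairing n k \<mu>)"] True
        EF_pairing[OF hom_down.prems hom_V[OF hom_down.hyps(2)] hom_supp[OF hom_down.hyps(2)]]
      by simp
  qed
qed

lemma R_E: "R v f \<Longrightarrow> k < n \<Longrightarrow> R (E k *v v) (eu k f)"
proof (induction rule: R.induct)
  case R_0
  then show ?case using R.R_0 by (simp add: osc_linear)
next
  case (R_step v f \<mu> w g c)
  then show ?case
    using R_lin[OF hom_E[OF R_step.hyps(2), of k] R_step.IH, of c]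
    by (simp add: osc_linear matrix_vector_right_distrib matrix_vector_mult_smult)
qed

text \<open>Only the empty word contributes to the weight \<open>\<Lambda>\<close>. This prevents
  \<open>vp\<close> from being matched with 0.\<close>

lemma R_top_component: "R v f \<Longrightarrow> P \<Lambda> *v v = f \<Lambda> *s vp"
proof (induction rule: R.induct)
  case (R_step v f \<mu> w g c)
  have "P \<Lambda> *v w = g \<Lambda> *s vp"
  proof (cases "\<mu> = \<Lambda>")
    case True
    then have "w = vp" "g = delta \<Lambda>" using hom_ht[OF R_step.hyps(2)] by auto
    then show ?thesis using P_proj[OF vp(1), of \<Lambda>] by (auto simp: \<Lambda> delta_def)
  next
    case False
    then show ?thesis
      using P_proj[OF hom_V[OF R_step.hyps(2)] hom_supp[OF R_step.hyps(2)], of \<Lambda>]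
        hom_fun[OF R_step.hyps(2), of \<Lambda>] by auto
  qed
  then show ?case using R_step.IH
    by (simp add: matrix_vector_right_distrib matrix_vector_mult_smult vector_sadd_rdistrib vector_smult_assoc)
qed simp

text \<open>The vectors matched with 0 form a submodule without \<open>vp\<close>, which is zero by
  irreducibility.\<close>

lemma R_zero:
  assumes "R v (\<lambda>_. 0)" shows "v = 0"
proof -
  let ?Z = "{v. R v (\<lambda>_. 0)}"
  have "?Z = {0} \<or> ?Z = UNIV"
  proof (rule simple)
    show "vec.subspace ?Z" unfolding vec.subspace_def
    proof (intro conjI ballI allI)
      fix x y c assume x: "x \<in> ?Z"
      show "c *s x \<in> ?Z" using R_lin[OF _ R_0, of x "\<lambda>_. 0" c] x by simp
      assume y: "y \<in> ?Z"
      show "x + y \<in> ?Z" using R_lin[of y "\<lambda>_. 0" x "\<lambda>_. 0" 1] x y by simp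
    qed (simp add: R_0)
  next
    fix k w assume "k < n" "w \<in> ?Z"
    then show "E k *v w \<in> ?Z \<and> F k *v w \<in> ?Z"
      using R_E[of w "\<lambda>_. 0" k] R_F[of w "\<lambda>_. 0" k] by (simp add: osc_linear)
  qed
  moreover have "vp \<notin> ?Z"
  proof
    assume "vp \<in> ?Z"
    then have "P \<Lambda> *v vp = 0" using R_top_component by fastforce
    then show False using P_proj[OF vp(1), of \<Lambda>] vp(2) by (auto simp: \<Lambda>)
  qed
  ultimately show ?thesis using assms by auto
qed

lemma R_unique: "R v f \<Longrightarrow> R w f \<Longrightarrow> v = w"
  using R_zero[of "v - w"] R_diff[of v f w f] by simp

lemma R_total: "\<exists>f. R v f"
proof -
  let ?D = "{v. \<exists>f. R v f}"
  have "?D = {0} \<or> ?D = UNIV"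
  proof (rule simple)
    show "vec.subspace ?D" unfolding vec.subspace_def
    proof (intro conjI ballI allI)
      fix x y c assume x: "x \<in> ?D"
      show "c *s x \<in> ?D" using R_lin[OF _ R_0, of x _ c] x by auto
      assume y: "y \<in> ?D"
      show "x + y \<in> ?D" using R_lin[of y _ x _ 1] x y by (simp, blast)
    qed (use R_0 in auto)
  next
    fix k w assume "k < n" "w \<in> ?D"
    then show "E k *v w \<in> ?D \<and> F k *v w \<in> ?D" using R_E R_F by blast
  qed
  moreover have "vp \<in> ?D" using R_hom[OF hom_top] by blast
  ultimately show ?thesis using vp(2) by auto
qed

section \<open>Weight spaces as lines, and the weights that occur\<close>

definition single :: "(nat \<Rightarrow> int) \<Rightarrow> 'a \<Rightarrow> (nat \<Rightarrow> int) \<Rightarrow> 'a" where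
  "single \<mu> c = (\<lambda>\<nu>. if \<nu> = \<mu> then c else 0)"

text \<open>The generating pairs are homogeneous, so \<open>R\<close> is graded by weights.\<close>

lemma R_project: "R v f \<Longrightarrow> R (P \<mu> *v v) (single \<mu> (f \<mu>))"
proof (induction rule: R.induct)
  case R_0
  then show ?case using R.R_0 by (simp add: single_def)
next
  case (R_step v f \<nu> w g c)
  note Pw = P_proj[OF hom_V[OF R_step.hyps(2)] hom_supp[OF R_step.hyps(2)], of \<mu>]
  show ?case
  proof (cases "\<mu> = \<nu>")
    case True
    have "single \<mu> (f \<mu> + c * g \<mu>) = (\<lambda>\<nu>. single \<mu> (f \<mu>) \<nu> + c * g \<nu>)"
      using hom_fun[OF R_step.hyps(2)] True by (auto simp: single_def)
    then show ?thesis
      using R.R_step[OF R_step.IH R_step.hyps(2), of c] Pw True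
      by (simp add: matrix_vector_right_distrib matrix_vector_mult_smult)
  next
    case False
    then show ?thesis using R_step.IH Pw hom_fun[OF R_step.hyps(2), of \<mu>]
      by (simp add: matrix_vector_right_distrib matrix_vector_mult_smult)
  qed
qed

lemma R_weight_vector:
  assumes "v \<in> V \<mu>" "\<forall>j\<ge>n. \<mu> j = 0"
  shows "\<exists>c. R v (single \<mu> c)"
  using R_total[of v] R_project[of v _ \<mu>] P_proj[OF assms, of \<mu>] by auto

text \<open>Vectors of one weight are matched with multiples of one monomial; after scaling,
  uniqueness applies.\<close>

lemma weight_space_line:
  assumes "v \<in> V \<mu>" "w \<in> V \<mu>" "\<forall>j\<ge>n. \<mu> j = 0" "v \<noteq> 0"
  shows "\<exists>c. w = c *s v"
proof -
  obtain a b where ab: "R v (single \<mu> a)" "R w (single \<mu> b)"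
    using R_weight_vector assms by meson
  have "a \<noteq> 0"
    using ab(1) R_zero[of v] assms(4) by (auto simp: single_def)
  have "R ((b / a) *s v) (single \<mu> b)"
    using R_lin[OF ab(1) R_0, of "b / a"] \<open>a \<noteq> 0\<close> by (simp add: single_def if_distrib cong: if_cong)
  then show ?thesis using R_unique[OF ab(2)] by blast
qed

definition occurs :: "(nat \<Rightarrow> int) \<Rightarrow> bool" where
  "occurs \<mu> \<longleftrightarrow> (\<exists>v c. R v (single \<mu> c) \<and> v \<noteq> 0)"

lemma occurs_weight: assumes "occurs \<mu>" shows "\<exists>v\<in>V \<mu>. v \<noteq> 0"
proof -
  obtain v c where v: "R v (single \<mu> c)" "v \<noteq> 0" using assms by (auto simp: occurs_def)
  have "R (P \<mu> *v v) (single \<mu> c)" using R_project[OF v(1), of \<mu>] by (simp add: single_def)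
  then have "v = P \<mu> *v v" using R_unique v(1) by blast
  then show ?thesis using v(2) P_weight[of \<mu> v] by metis
qed

text \<open>Lowering followed by raising multiplies the monomial by a nonzero scalar, so lowering
  cannot kill the vector.\<close>

lemma occurs_down:
  assumes k: "k < n" and occ: "occurs (up n k \<mu>)"
    and nz: "if k + 1 < n then of_int (m - \<mu> k) \<noteq> (0::'a) \<and> of_int (m - \<mu> (k+1) + 1) \<noteq> (0::'a)
       else of_int (m - \<mu> k) \<noteq> (0::'a) \<and> of_int (m - \<mu> k - 1) \<noteq> (0::'a)"
  shows "occurs \<mu>"
proof -
  obtain v c where v: "R v (single (up n k \<mu>) c)" "v \<noteq> 0" using occ by (auto simp: occurs_def)
  \<comment> \<open>The product of the oscillator coefficients for the step down to \<mu> and back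
    up.\<close>
  define \<kappa> :: 'a where "\<kappa> = (if k + 1 < n then of_int (m - \<mu> k) * of_int (m - \<mu> (k+1) + 1)
     else - of_int ((m - \<mu> k) * (m - \<mu> k - 1)) / 2 * (1 / 2))"
  have "(2::'a) * 2 \<noteq> 0" using two_nonzero by (simp only: mult_eq_0_iff) simp
  then have "\<kappa> \<noteq> 0" using nz two_nonzero by (auto simp: \<kappa>_def)
  have s: "ed k (single (up n k \<mu>) c) = single \<mu> (ed k (single (up n k \<mu>) c) \<mu>)"
    by (intro ext) (auto simp: osc_down_def single_def up_eq_iff)
  have e: "eu k (ed k (single (up n k \<mu>) c)) = single (up n k \<mu>) (\<kappa> * c)"
    by (intro ext, auto simp: osc_up_def osc_down_def single_def \<kappa>_def)
       (auto simp: up_def sroot_def)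
  have "F k *v v \<noteq> 0"
  proof
    assume "F k *v v = 0"
    then have "R 0 (single (up n k \<mu>) (\<kappa> * c))"
      using R_E[OF R_F[OF v(1) k] k] by (simp add: e)
    from R_lin[OF this v(1), of "- 1 / \<kappa>"] have "R v (\<lambda>_. 0)"
      using \<open>\<kappa> \<noteq> 0\<close> by (simp add: single_def if_distrib cong: if_cong)
    then show False using R_zero v(2) by blast
  qed
  moreover have "R (F k *v v) (single \<mu> (ed k (single (up n k \<mu>) c) \<mu>))"
    using R_F[OF v(1) k] s by simp
  ultimately show ?thesis by (auto simp: occurs_def)
qed

lemma up_in_box:
  assumes k: "k < n" and \<mu>: "\<mu> \<in> weyl_box n m \<delta>" and "\<forall>j<n. \<bar>up n k \<mu> j\<bar> \<le> m"
  shows "up n k \<mu> \<in> weyl_box n m \<delta>"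
proof -
  have "even (\<Sum>j<n. sroot n k j)" by (rule even_sum_sroot)
  moreover have "(\<Sum>j<n. m - up n k \<mu> j) = (\<Sum>j<n. m - \<mu> j) - (\<Sum>j<n. sroot n k j)"
    by (simp add: up_def sum_subtractf sum.distrib)
  moreover have "sroot n k j = 0" if "j \<ge> n" for j using that k by (auto simp: sroot_def)
  ultimately show ?thesis using \<mu> assms(3) by (auto simp: weyl_box_def cube_def up_def)
qed

text \<open>Induction from the top. The long root is added while the last coordinate is at least 2
  below \<open>m\<close>, then a short root; the scalars lie between 1 and \<open>2 * m\<close> and
  are nonzero. Only \<open>\<Lambda>\<close> admits neither step.\<close>

lemma occurs_box: "\<mu> \<in> weyl_box n m \<delta> \<Longrightarrow> occurs \<mu>"
proof (induction "nat (ht n (\<lambda>_. m) - ht n \<mu>)" arbitrary: \<mu> rule: less_induct)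
  case less
  have b: "\<forall>j\<ge>n. \<mu> j = 0" "\<And>j. j < n \<Longrightarrow> \<bar>\<mu> j\<bar> \<le> m" "even ((\<Sum>j<n. m - \<mu> j) - \<delta>)"
    using less.prems by (auto simp: weyl_box_def cube_def)
  have occ: "occurs (up n k \<mu>)" if k: "k < n" and in_box: "\<forall>j<n. \<bar>up n k \<mu> j\<bar> \<le> m" for k
  proof (rule less.hyps[OF _ up_in_box[OF k less.prems in_box]])
    have "ht n (up n k \<mu>) \<le> ht n (\<lambda>_. m)"
      unfolding ht_def by (rule sum_mono) (use in_box in \<open>auto intro!: mult_left_mono\<close>)
    then show "nat (ht n (\<lambda>_. m) - ht n (up n k \<mu>)) < nat (ht n (\<lambda>_. m) - ht n \<mu>)"
      using ht_sroot[OF k] by (simp add: ht_up)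
  qed
  have bl: "\<bar>\<mu> (n-1)\<bar> \<le> m" using b(2)[of "n-1"] n by auto
  show ?case
  proof (cases "m - \<mu> (n-1) \<ge> 2")
    case True
    show ?thesis
    proof (rule occurs_down[of "n-1"])
      show "occurs (up n (n-1) \<mu>)"
      proof (rule occ)
        have "\<bar>\<mu> (n-1) + 2\<bar> \<le> m" using bl True by linarith
        then show "\<forall>j<n. \<bar>up n (n-1) \<mu> j\<bar> \<le> m" using b(2) n by (auto simp: up_def sroot_def)
      qed (use n in simp)
      show "if n - 1 + 1 < n then of_int (m - \<mu> (n-1)) \<noteq> (0::'a) \<and> of_int (m - \<mu> (n-1+1) + 1) \<noteq> (0::'a)
         else of_int (m - \<mu> (n-1)) \<noteq> (0::'a) \<and> of_int (m - \<mu> (n-1) - 1) \<noteq> (0::'a)"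
        using True bl n of_int_nonzero[of "m - \<mu> (n-1)"] of_int_nonzero[of "m - \<mu> (n-1) - 1"] by simp
    qed (use n in simp)
  next
    case last: False
    show ?thesis
    proof (cases "\<exists>k. k + 1 < n \<and> \<mu> k < m")
      case True
      \<comment> \<open>By maximality the next coordinate is at least \<open>m - 1\<close>, so it
        may drop by 1, and the corresponding scalar is 1 or 2.\<close>
      define k where "k = Max {k. k + 1 < n \<and> \<mu> k < m}"
      have fin: "finite {k. k + 1 < n \<and> \<mu> k < m}" by (rule finite_subset[of _ "{..n}"]) auto
      have "k \<in> {k. k + 1 < n \<and> \<mu> k < m}" unfolding k_def by (rule Max_in) (use fin True in auto)
      then have k: "k + 1 < n" "\<mu> k < m" by auto
      have next_k: "m - \<mu> (k+1) \<le> 1"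
      proof (cases "k + 2 < n")
        case True
        have "\<not> \<mu> (k+1) < m"
        proof
          assume "\<mu> (k+1) < m"
          then have "k + 1 \<le> k" using True fin unfolding k_def by (intro Max_ge) auto
          then show False by simp
        qed
        then show ?thesis by simp
      next
        case False
        then have "k + 1 = n - 1" using k by simp
        then show ?thesis using last by simp
      qed
      have bk: "\<bar>\<mu> k\<bar> \<le> m" "\<bar>\<mu> (k+1)\<bar> \<le> m" using b(2) k by auto
      show ?thesis
      proof (rule occurs_down[of k])
        show "occurs (up n k \<mu>)"
        proof (rule occ)
          have "\<bar>\<mu> k + 1\<bar> \<le> m" "\<bar>\<mu> (k+1) - 1\<bar> \<le> m" using bk k next_k m by linarith+
          then show "\<forall>j<n. \<bar>up n k \<mu> j\<bar> \<le> m" using b(2) k by (auto simp: up_def sroot_def)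
        qed (use k in simp)
        show "if k + 1 < n then of_int (m - \<mu> k) \<noteq> (0::'a) \<and> of_int (m - \<mu> (k+1) + 1) \<noteq> (0::'a)
           else of_int (m - \<mu> k) \<noteq> (0::'a) \<and> of_int (m - \<mu> k - 1) \<noteq> (0::'a)"
          using k bk next_k m of_int_nonzero[of "m - \<mu> k"] of_int_nonzero[of "m - \<mu> (k+1) + 1"] by simp
      qed (use k in simp)
    next
      case False
      have eqm: "\<mu> j = m" if "j < n" "j \<noteq> n - 1" for j
      proof -
        have "j + 1 < n" using that by arith
        then have "\<not> \<mu> j < m" using False by blast
        then show ?thesis using b(2)[OF that(1)] by linarith
      qed
      have "(\<Sum>j<n. m - \<mu> j) = (\<Sum>j<n. if j = n - 1 then m - \<mu> (n-1) else 0)"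
        by (rule sum.cong) (auto simp: eqm)
      then have "(\<Sum>j<n. m - \<mu> j) = m - \<mu> (n-1)" using n by simp
      \<comment> \<open>The last coordinate is \<open>m\<close> or \<open>m - 1\<close>, and parity
        decides which.\<close>
      then have "even (m - \<mu> (n-1) - \<delta>)" "0 \<le> m - \<mu> (n-1)" "m - \<mu> (n-1) \<le> 1"
        using b(3) bl last by auto
      moreover have "x = y" if "even (x - y)" "0 \<le> x" "x \<le> 1" "y \<in> {0, 1}" for x y :: int
        using that by (cases "x = 0"; cases "x = 1") auto
      ultimately have "m - \<mu> (n-1) = \<delta>" using \<delta> by blast
      then have "\<mu> (n-1) = m - \<delta>" by simp
      then have "\<mu> = \<Lambda>" using eqm b(1) by (auto simp: \<Lambda> fun_eq_iff)
      moreover have "R vp (single \<Lambda> 1)" using R_hom[OF hom_top] by (simp add: delta_def single_def)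
      ultimately show ?thesis using vp(2) by (auto simp: occurs_def)
    qed
  qed
qed

section \<open>Multiplicities and dimension\<close>

theorem weight_space_dim:
  assumes "\<forall>j\<ge>n. \<mu> j = 0" "V \<mu> \<noteq> {0}" shows "vec.dim (V \<mu>) = 1"
proof -
  obtain v where v: "v \<in> V \<mu>" "v \<noteq> 0" using assms(2) V_subspace[of \<mu>] vec.subspace_0 by blast
  have "V \<mu> = vec.span {v}"
  proof
    show "V \<mu> \<subseteq> vec.span {v}"
      using weight_space_line[OF v(1) _ assms(1) v(2)] by (auto simp: vec.span_singleton)
    show "vec.span {v} \<subseteq> V \<mu>" using V_subspace v(1) by (intro vec.span_minimal) auto
  qed
  then show ?thesis using v(2) by (simp add: vec.dim_span vec.dim_eq_card_independent)
qed

text \<open>One nonzero vector for each weight of the box gives a basis: independent by the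
  projections, spanning because weight spaces are lines.\<close>

theorem dimension: "2 * int CARD('d) = (2 * m + 1) ^ n + (if \<delta> = 0 then 1 else -1)"
proof -
  let ?B = "weyl_box n m \<delta>"
  have supp: "\<forall>j\<ge>n. \<mu> j = 0" if "\<mu> \<in> ?B" for \<mu> using that by (auto simp: weyl_box_def cube_def)
  have fin: "finite ?B" using finite_cube[of n m] by (auto simp: weyl_box_def)
  obtain b where b: "\<And>\<mu>. \<mu> \<in> ?B \<Longrightarrow> b \<mu> \<in> V \<mu> \<and> b \<mu> \<noteq> 0"
    using occurs_weight[OF occurs_box] by metis
  have Pb: "P \<nu> *v b \<mu> = (if \<nu> = \<mu> then b \<mu> else 0)" if "\<mu> \<in> ?B" for \<mu> \<nu>
    using P_proj[OF conjunct1[OF b[OF that]] supp[OF that]] .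
  have inj: "inj_on b ?B"
  proof (rule inj_onI)
    fix \<mu> \<nu> assume "\<mu> \<in> ?B" "\<nu> \<in> ?B" "b \<mu> = b \<nu>"
    then show "\<mu> = \<nu>" using Pb[of \<mu> \<mu>] Pb[of \<nu> \<mu>] b[of \<mu>] by (auto split: if_splits)
  qed
  have "vec.independent (b ` ?B)"
  proof (rule vec.independent_if_scalars_zero)
    fix f x assume sum0: "(\<Sum>x\<in>b ` ?B. f x *s x) = 0" and "x \<in> b ` ?B"
    then obtain \<nu> where \<nu>: "\<nu> \<in> ?B" "x = b \<nu>" by blast
    have "0 = P \<nu> *v (\<Sum>\<mu>\<in>?B. f (b \<mu>) *s b \<mu>)"
      using sum0 by (simp add: sum.reindex[OF inj])
    also have "\<dots> = (\<Sum>\<mu>\<in>?B. if \<mu> = \<nu> then f (b \<nu>) *s b \<nu> else 0)"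
      unfolding matrix_vector_mult_sum matrix_vector_mult_smult
      by (rule sum.cong) (auto simp: Pb)
    also have "\<dots> = f x *s x" using fin \<nu> by simp
    finally show "f x = 0" using \<nu> b by simp
  qed (use fin in simp)
  moreover have "vec.span (b ` ?B) = UNIV"
  proof -
    have "P \<eta> *v v \<in> vec.span (b ` ?B)" if "\<eta> \<in> wts" for \<eta> v
    proof (cases "P \<eta> *v v = 0")
      case False
      have s: "\<forall>j\<ge>n. \<eta> j = 0" using that wts by blast
      have "\<eta> \<in> ?B" using weights_in_box[OF s P_weight False] .
      then obtain c where "P \<eta> *v v = c *s b \<eta>"
        using weight_space_line[OF _ P_weight s] b by blast
      then show ?thesis using \<open>\<eta> \<in> ?B\<close> by (simp add: vec.span_scale vec.span_base)
    qed (simp add: vec.span_zero)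
    then have "v \<in> vec.span (b ` ?B)" for v
      by (subst P_sum[of v]) (rule vec.span_sum)
    then show ?thesis by blast
  qed
  ultimately have "CARD('d) = card (b ` ?B)"
    by (metis vec.dim_eq_card vec.span_UNIV vec_dim_card)
  also have "\<dots> = card ?B" by (rule card_image[OF inj])
  finally show ?thesis using card_weyl_box[of m \<delta> n] m \<delta> by simp
qed

end

section \<open>Weights of the representation\<close>

lemma simple_root_Suc: "k < n \<Longrightarrow> simple_root n (Suc k) = sroot n k"
  by (auto simp: simple_root_def sroot_def eps_def fun_eq_iff)

lemma sum_simple_root:
  "(\<Sum>k\<in>{1..n}. int (c k) * simple_root n k j) = (\<Sum>k<n. int (c (Suc k)) * sroot n k j)"
proof -
  have "(\<Sum>k\<in>{1..n}. int (c k) * simple_root n k j) = (\<Sum>k<n. int (c (Suc k)) * simple_root n (Suc k) j)"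
    by (rule sum.reindex_bij_witness[of _ Suc "\<lambda>k. k - 1"]) auto
  also have "\<dots> = (\<Sum>k<n. int (c (Suc k)) * sroot n k j)"
    by (rule sum.cong) (auto simp: simple_root_Suc)
  finally show ?thesis .
qed

context rational_sp_rep
begin

lemma is_weightI: "v \<in> V \<mu> \<Longrightarrow> v \<noteq> 0 \<Longrightarrow> \<forall>j\<ge>n. \<mu> j = 0 \<Longrightarrow> is_weight n \<rho> \<mu>"
  by (auto simp: is_weight_def)

lemma is_weightE:
  assumes "is_weight n \<rho> \<mu>" obtains v where "v \<in> V \<mu>" "v \<noteq> 0" "\<forall>j\<ge>n. \<mu> j = 0"
  using assms vec.subspace_0[OF subspace_weight_space[of \<mu>]] by (auto simp: is_weight_def)

section \<open>Weyl group symmetry and bounds on the weights\<close>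

text \<open>An element normalizing the torus permutes the weight spaces; \<tau> is the induced map
  of the torus, and \<open>U\<close> undoes \<open>T\<close>, so nonzero vectors stay
  nonzero.\<close>

lemma is_weight_transport:
  fixes T U :: "'a mat2 \<Rightarrow> 'a mat2" and \<tau> :: "(nat \<Rightarrow> 'a) \<Rightarrow> nat \<Rightarrow> 'a"
  assumes T: "symp_op n T" and U: "symp_op n U" and inv: "U (T (mid n)) = mid n"
    and D: "\<And>h. \<forall>i<n. h i \<noteq> 0 \<Longrightarrow> opD n h (T (mid n)) = T (opD n (\<tau> h) (mid n))
        \<and> (\<forall>i<n. \<tau> h i \<noteq> 0) \<and> character n \<mu> (\<tau> h) = character n \<mu>' h"
    and \<mu>: "is_weight n \<rho> \<mu>" and \<mu>': "\<forall>j\<ge>n. \<mu>' j = 0"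
  shows "is_weight n \<rho> \<mu>'"
proof -
  obtain v where v: "v \<in> V \<mu>" "v \<noteq> 0" using \<mu> by (rule is_weightE)
  let ?w = "\<rho> (T (mid n)) *v v"
  have "\<rho> (U (mid n)) *v ?w = v" using rho_op[OF U op_mid_in_Sp[OF T], of v] by (simp add: inv rho_mid)
  then have "?w \<noteq> 0" using v(2) by auto
  moreover have "?w \<in> V \<mu>'" unfolding weight_space_def
  proof (intro CollectI allI impI)
    fix h :: "nat \<Rightarrow> 'a" assume h: "\<forall>i<n. h i \<noteq> 0"
    note Dh = D[OF h]
    have "\<rho> (torus_elt n h) *v ?w = \<rho> (opD n h (T (mid n))) *v v"
      using rho_op[OF symp_op_opD[OF h] op_mid_in_Sp[OF T], of v] by (simp add: torus_elt_eq_opD)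
    also have "\<dots> = \<rho> (T (mid n)) *v (\<rho> (torus_elt n (\<tau> h)) *v v)"
      using rho_op[OF T op_mid_in_Sp[OF symp_op_opD], of "\<tau> h" v] Dh by (simp add: torus_elt_eq_opD)
    also have "\<dots> = character n \<mu>' h *s ?w"
      using weight_spaceD[OF v(1), of "\<tau> h"] Dh by (simp add: matrix_vector_mult_smult)
    finally show "\<rho> (torus_elt n h) *v ?w = character n \<mu>' h *s ?w" .
  qed
  ultimately show ?thesis using \<mu>' by (intro is_weightI) auto
qed

text \<open>Transpositions with coordinate 0, together with the sign change of that coordinate,
  generate the Weyl group.\<close>

lemma is_weight_swap:
  assumes i: "i < n" and \<mu>: "is_weight n \<rho> \<mu>"
  shows "is_weight n \<rho> (\<lambda>j. \<mu> (if j = 0 then i else if j = i then 0 else j))"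
proof (rule is_weight_transport[OF symp_op_opS[OF i] symp_op_opS[OF i] _ _ \<mu>])
  let ?t = "\<lambda>j. if j = 0 then i else if j = i then 0 else j"
  show "opS n i (opS n i (mid n)) = (mid n :: 'a mat2)"
    using i by (auto simp: opS_def fun_eq_iff)
  fix h :: "nat \<Rightarrow> 'a" assume h: "\<forall>i<n. h i \<noteq> 0"
  have "opD n h (opS n i (mid n)) = opS n i (opD n (\<lambda>j. h (?t j)) (mid n))"
    using i by (auto simp: opS_def opD_def fun_eq_iff)
  moreover have "\<forall>j<n. h (?t j) \<noteq> 0" using h i by auto
  moreover have "character n \<mu> (\<lambda>j. h (?t j)) = character n (\<lambda>j. \<mu> (?t j)) h"
    unfolding character_def
    by (rule prod.reindex_bij_witness[of _ ?t ?t]) (use i in \<open>auto split: if_splits\<close>)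
  ultimately show "opD n h (opS n i (mid n)) = opS n i (opD n (\<lambda>j. h (?t j)) (mid n)) \<and>
     (\<forall>j<n. h (?t j) \<noteq> 0) \<and> character n \<mu> (\<lambda>j. h (?t j)) = character n (\<lambda>j. \<mu> (?t j)) h" by blast
next
  show "\<forall>j\<ge>n. \<mu> (if j = 0 then i else if j = i then 0 else j) = 0"
    using \<mu> i by (auto simp: is_weight_def)
qed

lemma is_weight_negate:
  assumes n: "n \<ge> 1" and \<mu>: "is_weight n \<rho> \<mu>"
  shows "is_weight n \<rho> (\<mu>(0 := - \<mu> 0))"
proof (rule is_weight_transport[OF symp_op_opW[OF n, of 1] symp_op_opW[OF n, of "-1"] _ _ \<mu>])
  show "opW n (-1) (opW n 1 (mid n)) = (mid n :: 'a mat2)"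
    using n by (auto simp: opW_def fun_eq_iff)
  fix h :: "nat \<Rightarrow> 'a" assume h: "\<forall>i<n. h i \<noteq> 0"
  have "opD n h (opW n 1 (mid n)) = opW n 1 (opD n (h(0 := inverse (h 0))) (mid n))"
    using n by (auto simp: opW_def opD_def fun_eq_iff)
  moreover have "\<forall>j<n. (h(0 := inverse (h 0))) j \<noteq> 0" using h n by auto
  moreover have "character n \<mu> (h(0 := inverse (h 0))) = character n (\<mu>(0 := - \<mu> 0)) h"
    unfolding character_def
    by (rule prod.cong) (auto simp: power_int_inverse power_int_minus)
  ultimately show "opD n h (opW n 1 (mid n)) = opW n 1 (opD n (h(0 := inverse (h 0))) (mid n)) \<and>
     (\<forall>j<n. (h(0 := inverse (h 0))) j \<noteq> 0) \<and>
     character n \<mu> (h(0 := inverse (h 0))) = character n (\<mu>(0 := - \<mu> 0)) h" by blast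
next
  show "\<forall>j\<ge>n. (\<mu>(0 := - \<mu> 0)) j = 0" using \<mu> n by (auto simp: is_weight_def)
qed simp_all

text \<open>The Weyl group brings any coordinate, with either sign, to position 0.\<close>

lemma weights_bounded:
  assumes bound: "\<And>\<mu>. is_weight n \<rho> \<mu> \<Longrightarrow> \<mu> 0 \<le> m" and \<mu>: "is_weight n \<rho> \<mu>" and j: "j < n"
  shows "\<bar>\<mu> j\<bar> \<le> m"
proof -
  have n: "n \<ge> 1" using j by simp
  note s = is_weight_swap[OF j \<mu>]
  show ?thesis using bound[OF s] bound[OF is_weight_negate[OF n s]] by (auto simp: abs_le_iff)
qed

lemma is_weight_shift:
  "is_weight n \<rho> \<mu> \<Longrightarrow> k < n \<Longrightarrow> \<forall>j\<ge>n. \<mu> j + z * sroot n k j = 0"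
  by (auto simp: is_weight_def sroot_def)

section \<open>From stability under root vectors to stability under the group\<close>

text \<open>A shift by more than the width \<open>2 * m\<close> of the cube cannot lead from a
  weight to a weight.\<close>

lemma step_eq_0:
  assumes bound: "\<And>\<mu> j. is_weight n \<rho> \<mu> \<Longrightarrow> j < n \<Longrightarrow> \<bar>\<mu> j\<bar> \<le> m"
    and k: "k < n" and z: "\<bar>z\<bar> > 2 * m"
    and M: "\<And>v \<mu>. v \<in> V \<mu> \<Longrightarrow> M *v v \<in> V (\<lambda>j. \<mu> j + z * sroot n k j)"
  shows "M *v v = 0"
proof -
  obtain F P where FP: "weight_projections F P" using ex_weight_projections by blast
  have "M *v (P \<eta> *v v) = 0" if "\<eta> \<in> F" for \<eta>
  proof (rule ccontr)
    assume nz: "M *v (P \<eta> *v v) \<noteq> 0"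
    then have "P \<eta> *v v \<noteq> 0" by auto
    moreover have P: "P \<eta> *v v \<in> V \<eta>" "\<forall>j\<ge>n. \<eta> j = 0" using FP that by (auto simp: weight_projections_def)
    ultimately have w: "is_weight n \<rho> \<eta>" by (intro is_weightI)
    have w': "is_weight n \<rho> (\<lambda>j. \<eta> j + z * sroot n k j)"
      by (rule is_weightI[OF M[OF P(1)] nz is_weight_shift[OF w k]])
    have "\<bar>\<eta> k\<bar> \<le> m" "\<bar>\<eta> k + z * sroot n k k\<bar> \<le> m" using bound[OF w k] bound[OF w' k] by auto
    moreover have "sroot n k k = 1 \<or> sroot n k k = 2" by (auto simp: sroot_def)
    ultimately show False using z by auto
  qed
  moreover have "v = (\<Sum>\<eta>\<in>F. P \<eta> *v v)" using FP by (simp add: weight_projections_def)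
  ultimately show ?thesis by (metis (no_types, lifting) matrix_vector_mult_sum sum.neutral)
qed

text \<open>Positive indices below the characteristic are invertible, so those \<open>E i\<close>
  are multiples of powers of \<open>E 1\<close>; the others vanish.\<close>

lemma expansion_stable:
  assumes ex: "expansion \<alpha> X E" and W: "vec.subspace W"
    and E1: "\<And>w. w \<in> W \<Longrightarrow> E 1 *v w \<in> W"
    and trunc: "\<And>i v. i \<ge> CHAR('a) \<Longrightarrow> E i *v v = 0" and w: "w \<in> W"
  shows "\<rho> (X t (mid n)) *v w \<in> W"
proof -
  obtain D where D: "\<And>t v. \<rho> (X t (mid n)) *v v = (\<Sum>k<D. t ^ k *s (E k *v v))"
    using ex by (auto simp: expansion_def)
  have E: "E i *v w \<in> W" for i
  proof (induction i)
    case 0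
    then show ?case using ex w by (simp add: expansion_def)
  next
    case (Suc i)
    show ?case
    proof (cases "Suc i \<ge> CHAR('a)")
      case True
      then show ?thesis using trunc W by (simp add: vec.subspace_0)
    next
      case False
      then have nz: "of_nat (Suc i) \<noteq> (0::'a)"
        unfolding of_nat_eq_0_iff_char_dvd using dvd_imp_le by blast
      have "of_nat (Suc i) *s (E (Suc i) *v w) \<in> W"
        using ex E1[OF Suc.IH] unfolding expansion_def by metis
      then have "inverse (of_nat (Suc i)) *s (of_nat (Suc i) *s (E (Suc i) *v w)) \<in> W"
        by (rule vec.subspace_scale[OF W])
      then show ?thesis using nz by (simp add: vector_smult_assoc del: of_nat_Suc)
    qed
  qed
  show ?thesis unfolding D
    by (rule vec.subspace_sum[OF W]) (rule vec.subspace_scale[OF W E])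
qed

text \<open>The width of the cube is one less than the characteristic, so the divided powers that
  are not polynomials in the root vectors vanish. Generation by simple root subgroups does the
  rest.\<close>

lemma stable_subspace:
  assumes bound: "\<And>\<mu> j. is_weight n \<rho> \<mu> \<Longrightarrow> j < n \<Longrightarrow> \<bar>\<mu> j\<bar> \<le> m"
    and p: "int CHAR('a) = 2 * m + 1"
    and W: "vec.subspace W"
    and stab: "\<And>k w. k < n \<Longrightarrow> w \<in> W \<Longrightarrow> raise k 1 *v w \<in> W \<and> lower k 1 *v w \<in> W"
    and "g \<in> Sp n" "w \<in> W"
  shows "\<rho> g *v w \<in> W"
proof -
  have r0: "raise k i *v v = 0" if "k < n" "i \<ge> CHAR('a)" for k i v
    by (rule step_eq_0[where m = m and k = k and z = "int i"])
      (use that p raise_weight bound in auto)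
  have l0: "lower k i *v v = 0" if "k < n" "i \<ge> CHAR('a)" for k i v
    by (rule step_eq_0[where m = m and k = k and z = "- int i"])
      (use that p lower_weight bound in auto)
  interpret sp_invariant n "\<lambda>g. \<forall>w\<in>W. \<rho> g *v w \<in> W"
  proof
    show "\<forall>w\<in>W. \<rho> (mid n) *v w \<in> W" by (simp add: rho_mid)
    fix k g t assume k: "k < n" and g: "g \<in> Sp n" and Q: "\<forall>w\<in>W. \<rho> g *v w \<in> W"
    show "\<forall>w\<in>W. \<rho> (xp n k t g) *v w \<in> W"
      using Q expansion_stable[OF expansion_raise[OF k] W, of _ t] stab[OF k] r0[OF k]
      by (auto simp: rho_op[OF symp_op_xp[OF k] g])
    show "\<forall>w\<in>W. \<rho> (xm n k t g) *v w \<in> W"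
      using Q expansion_stable[OF expansion_lower[OF k] W, of _ t] stab[OF k] l0[OF k]
      by (auto simp: rho_op[OF symp_op_xm[OF k] g])
  qed
  show ?thesis using Q_Sp[OF assms(5)] assms(6) by blast
qed

text \<open>\<open>\<Lambda> - \<mu>\<close> is a sum of simple roots, on each of which coordinate 0
  and the height are nonnegative and the coordinate sum is even.\<close>

lemma highest_weightD:
  assumes "highest_weight n \<rho> \<Lambda>" "is_weight n \<rho> \<mu>"
  shows "\<mu> 0 \<le> \<Lambda> 0" "even (\<Sum>j<n. \<Lambda> j - \<mu> j)" "ht n \<mu> \<le> ht n \<Lambda>"
proof -
  obtain c :: "nat \<Rightarrow> nat" where "\<forall>j. \<Lambda> j - \<mu> j = (\<Sum>k\<in>{1..n}. int (c k) * simple_root n k j)"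
    using assms by (auto simp: highest_weight_def)
  then have c: "\<And>j. \<Lambda> j - \<mu> j = (\<Sum>k<n. int (c (Suc k)) * sroot n k j)"
    unfolding sum_simple_root by blast
  have "\<Lambda> 0 - \<mu> 0 \<ge> 0" unfolding c by (rule sum_nonneg) (auto simp: sroot_def)
  then show "\<mu> 0 \<le> \<Lambda> 0" by simp
  have "(\<Sum>j<n. \<Lambda> j - \<mu> j) = (\<Sum>k<n. int (c (Suc k)) * (\<Sum>j<n. sroot n k j))"
    unfolding c sum_distrib_left by (rule sum.swap)
  then show "even (\<Sum>j<n. \<Lambda> j - \<mu> j)" using even_sum_sroot by (simp add: dvd_sum)
  have "ht n \<Lambda> - ht n \<mu> = (\<Sum>j<n. (int n - int j) * (\<Lambda> j - \<mu> j))"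
    by (simp add: ht_def sum_subtractf right_diff_distrib)
  also have "\<dots> = (\<Sum>k<n. int (c (Suc k)) * ht n (sroot n k))"
    unfolding c ht_def sum_distrib_left by (subst sum.swap) (simp add: mult.left_commute)
  also have "\<dots> \<ge> 0" by (rule sum_nonneg) (auto intro!: mult_nonneg_nonneg dest: ht_sroot)
  finally show "ht n \<mu> \<le> ht n \<Lambda>" by simp
qed

end

theorem theorem1:
  fixes n i :: nat and \<rho> :: "'a::field mat2 \<Rightarrow> 'a^'d^'d"
  assumes "alg_closed TYPE('a)"
    and "prime CHAR('a)" and "CHAR('a) > 2"
    and "n \<ge> 1" and "i \<in> {1, 2}"
    and "rational_rep n \<rho>" and "irreducible_rep n \<rho>"
    and "highest_weight n \<rho> (if i = 1 then omega' CHAR('a) n else omega'' CHAR('a) n)"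
  shows "2 * int CARD('d) = int CHAR('a) ^ n + (-1) ^ i
         \<and> (\<forall>\<mu>. is_weight n \<rho> \<mu> \<longrightarrow> vec.dim (weight_space n \<rho> \<mu>) = 1)"
proof -
  interpret rational_sp_rep n \<rho>
    using assms(6) alg_closed_infinite[OF assms(1)] by unfold_locales
  have "odd CHAR('a)" using assms(2,3) by (rule prime_odd_nat)
  then obtain m' where m': "CHAR('a) = 2 * m' + 1" by (rule oddE)
  define m where "m = int m'"
  have p: "int CHAR('a) = 2 * m + 1" and m: "m \<ge> 1" using m' assms(3) by (auto simp: m_def)
  define \<delta> :: int where "\<delta> = (if i = 1 then 1 else 0)"
  define \<Lambda> where "\<Lambda> = (\<lambda>j. if j < n then m - (if j = n - 1 then \<delta> else 0) else 0)"
  have "(if i = 1 then omega' CHAR('a) n else omega'' CHAR('a) n) = \<Lambda>"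
    unfolding omega'_def omega''_def p \<Lambda>_def \<delta>_def fund_weight_def fun_eq_iff using assms(4) by auto
  then have hw: "highest_weight n \<rho> \<Lambda>" using assms(8) by simp
  then have \<Lambda>w: "is_weight n \<rho> \<Lambda>" by (simp add: highest_weight_def)
  then obtain vp where vp: "vp \<in> V \<Lambda>" "vp \<noteq> 0" by (rule is_weightE)
  obtain F P where FP: "weight_projections F P" using ex_weight_projections by blast
  have "\<Lambda> 0 \<le> m" using assms(4) by (simp add: \<Lambda>_def \<delta>_def)
  then have bound: "\<bar>\<mu> j\<bar> \<le> m" if "is_weight n \<rho> \<mu>" "j < n" for \<mu> j
    using weights_bounded[OF _ that] highest_weightD(1)[OF hw] by (meson order_trans)
  interpret oscillator_module n m \<delta> "\<lambda>k. raise k 1" "\<lambda>k. lower k 1" V P F \<Lambda> vp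
  proof
    show "n \<ge> 1" "m \<ge> 1" "\<delta> \<in> {0, 1}" using assms(4) m by (auto simp: \<delta>_def)
    show "of_int z = (0::'a) \<longleftrightarrow> (2 * m + 1) dvd z" for z :: int
      by (simp add: of_int_eq_0_iff_char_dvd p)
    show "vec.subspace (V \<mu>)" for \<mu> by (rule subspace_weight_space)
    show "raise k 1 *v v \<in> V (up n k \<mu>)" if "k < n" "v \<in> V \<mu>" for k v \<mu>
      using raise_weight[OF that, of 1] by (simp add: up_def)
    show "lower k 1 *v v \<in> V (down n k \<mu>)" if "k < n" "v \<in> V \<mu>" for k v \<mu>
      using lower_weight[OF that, of 1] by (simp add: down_def)
    \<comment> \<open>Irreducibility under the group descends to the simple root vectors because the
      weights are small compared with the characteristic.\<close>
    show "W = {0} \<or> W = UNIV"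
      if "vec.subspace W" and stable: "\<And>k w. k < n \<Longrightarrow> w \<in> W \<Longrightarrow> raise k 1 *v w \<in> W \<and> lower k 1 *v w \<in> W" for W
    proof -
      have "\<rho> g *v w \<in> W" if "g \<in> Sp n" "w \<in> W" for g w
        by (rule stable_subspace[where m = m, OF _ p _ _ that]) (fact bound \<open>vec.subspace W\<close> stable)+
      then show ?thesis using assms(7) \<open>vec.subspace W\<close> unfolding irreducible_rep_def by blast
    qed
    show "\<mu> \<in> weyl_box n m \<delta>" if "\<forall>j\<ge>n. \<mu> j = 0" "v \<in> V \<mu>" "v \<noteq> 0" for \<mu> v
    proof -
      have w: "is_weight n \<rho> \<mu>" using that by (intro is_weightI)
      have "(\<Sum>j<n. m - \<Lambda> j) = (\<Sum>j<n. if j = n - 1 then \<delta> else 0)"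
        by (rule sum.cong) (auto simp: \<Lambda>_def)
      then have "(\<Sum>j<n. m - \<Lambda> j) = \<delta>" using assms(4) by simp
      then have "(\<Sum>j<n. m - \<mu> j) - \<delta> = (\<Sum>j<n. \<Lambda> j - \<mu> j)" by (simp add: sum_subtractf)
      then have "even ((\<Sum>j<n. m - \<mu> j) - \<delta>)" using highest_weightD(2)[OF hw w] by (simp only:)
      then show ?thesis unfolding weyl_box_def cube_def using that(1) bound[OF w] by blast
    qed
    show "raise k 1 *v vp = 0" if "k < n" for k
    proof (rule ccontr)
      \<comment> \<open>A nonzero raised vector would have a weight of greater height than the
        highest weight.\<close>
      assume nz: "raise k 1 *v vp \<noteq> 0"
      have "is_weight n \<rho> (up n k \<Lambda>)"
        by (rule is_weightI[OF _ nz])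
          (use raise_weight[OF that vp(1), of 1] is_weight_shift[OF \<Lambda>w that, of 1] in \<open>auto simp: up_def\<close>)
      from highest_weightD(3)[OF hw this] show False using ht_sroot[OF that] by (simp add: ht_up)
    qed
  qed (use FP vp raise_lower_commute raise_lower_pairing in \<open>auto simp: weight_projections_def \<Lambda>_def\<close>)
  have "2 * int CARD('d) = int CHAR('a) ^ n + (-1) ^ i"
    using dimension assms(5) unfolding p by (auto simp: \<delta>_def)
  moreover have "vec.dim (V \<mu>) = 1" if "is_weight n \<rho> \<mu>" for \<mu>
    using weight_space_dim[of \<mu>] that by (auto simp: is_weight_def)
  ultimately show ?thesis by blast
qed

end
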